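(* Let $G=(V,E)$ be a finite connected planar graph embedded in the plane, with arbitrary real coupling constants $(J_e)_{e\in E}$, $(U_e)_{e\in E}$, and let $A_1,A_2,B_1,B_2$ be pairwise disjoint sets of vertices lying on the outer face of $G$. Let $\mathcal N$ be the associated ordered set of nodes and let $\mathcal B$ be the associated coloring. Suppose that $\mathcal B$ is unbalanced (i.e. not balanced). Then in the Ashkin--Teller model on $G$, $$\langle\varphi_{A_1}\varphi^2_{A_2}\tilde\varphi_{B_1}\tilde\varphi^2_{B_2}\rangle=\frac1{2^{|\mathcal N|}}\sum_{S\in\mathcal P(\mathcal N)}(-1)^{|S\cap\mathcal B|}\langle\sigma_{\mathcal N\setminus S}\tilde\sigma_S\rangle=0 .$$ If $U=0$ (that is, $U_e=0$ for all $e$), then $\sigma$ and $\tilde\sigma$ are independent and identically distributed, and in particular $\langle\sigma_{\mathcal N\setminus S}\tilde\sigma_S\rangle=\langle\sigma_{\mathcal N\setminus S}\rangle\langle\sigma_S\rangle$ for all $S\in\mathcal P(\mathcal N)$. Moreover, if in this case $|\mathcal B|$ is even, then the second equality above can be rewritten as $$2\langle\sigma_{\mathcal N}\rangle=\sum_{S\in\mathcal P(\mathcal N)\setminus\{\emptyset,\mathcal N\}}(-1)^{|S\cap\mathcal B|+1}\langle\sigma_S\rangle\langle\sigma_{\mathcal N\setminus S}\rangle .$$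
   Context: The Ashkin--Teller model (free boundary conditions) on a finite graph $G=(V,E)$ with real coupling constants $J_e,U_e$ is the probability measure on pairs $(\sigma,\tilde\sigma)\in\{-1,1\}^V\times\{-1,1\}^V$ given by $$\mathbf P(\sigma,\tilde\sigma)=\frac1{\mathcal Z}\prod_{uv\in E}\exp\big(J_{uv}(\sigma_u\sigma_v+\tilde\sigma_u\tilde\sigma_v)+U_{uv}(\sigma_u\sigma_v\tilde\sigma_u\tilde\sigma_v+1)\big),$$ with $\mathcal Z$ the normalizing constant; $\langle\cdot\rangle$ is the expectation. Define $\varphi_v=(\sigma_v+\tilde\sigma_v)/2$ and $\tilde\varphi_v=(\sigma_v-\tilde\sigma_v)/2$. For a set $A$, $\sigma_A=\prod_{v\in A}\sigma_v$, $\varphi_A=\prod_{v\in A}\varphi_v$, $\varphi_A^2=\prod_{v\in A}\varphi_v^2$, and similarly for $\tilde\sigma,\tilde\varphi$ (empty products equal $1$). Nodes and colorings: the vertices in $A_2\cup B_2$ are called doubled. The set of nodes $\mathcal N$ consists of the vertices of $A_1\cup B_1$ together with two copies $v^<,v^>$ of each doubled vertex $v$. It is assumed that $|\mathcal N|=2n$ is even. The nodes are ordered as $v_1<v_2<\dots<v_{2n}$ counterclockwise along the boundary of the outer face (starting anywhere; if a vertex is visited several times by the boundary walk, one of its visits is fixed), with $v^>$ coming immediately after $v^<$ for each doubled vertex $v$. In correlations, nodes are projected onto the underlying vertices, so $\sigma_{v^<}=\sigma_{v^>}=\sigma_v$ and likewise for $\tilde\sigma$. Nodes coming from $A_1\cup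 A_2$ are red (set $\mathcal R$), those coming from $B_1\cup B_2$ are blue (set $\mathcal B$); $\mathcal B$ is called a coloring. Let $\mathcal N_e,\mathcal N_o$ be the nodes of even and odd index. Sources and sinks are $$\mathcal S_+=(\mathcal N_o\cap\mathcal B)\cup(\mathcal N_e\cap\mathcal R),\qquad \mathcal S_-=(\mathcal N_e\cap\mathcal B)\cup(\mathcal N_o\cap\mathcal R),$$ and $\mathcal B$ is balanced if $|\mathcal S_+|=|\mathcal S_-|$. $\mathcal P(\mathcal N)$ denotes the set of subsets of $\mathcal N$ of even cardinality. *)

theory Defs
  imports
    "HOL-Probability.Probability"
    "HOL-Complex_Analysis.Complex_Analysis"
begin

section \<open>Plane graphs\<close>

definition simple_graph :: "'a set \<Rightarrow> 'a set set \<Rightarrow> bool" where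
  "simple_graph V E \<longleftrightarrow> finite V \<and> (\<forall>e\<in>E. e \<subseteq> V \<and> card e = 2)"

definition connected_graph :: "'a set \<Rightarrow> 'a set set \<Rightarrow> bool" where
  "connected_graph V E \<longleftrightarrow> V \<noteq> {} \<and> (\<forall>u\<in>V. \<forall>v\<in>V. (u, v) \<in> {(x, y). {x, y} \<in> E}\<^sup>*)"

definition plane_embedding ::
  "'a set \<Rightarrow> 'a set set \<Rightarrow> ('a \<Rightarrow> complex) \<Rightarrow> ('a set \<Rightarrow> real \<Rightarrow> complex) \<Rightarrow> bool" where
  "plane_embedding V E pos \<gamma> \<longleftrightarrow>
     inj_on pos V \<and>
     (\<forall>e\<in>E. arc (\<gamma> e) \<and> {pathstart (\<gamma> e), pathfinish (\<gamma> e)} = pos ` e \<and>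
             path_image (\<gamma> e) \<inter> pos ` V = pos ` e) \<and>
     (\<forall>e\<in>E. \<forall>e'\<in>E. e \<noteq> e' \<longrightarrow> path_image (\<gamma> e) \<inter> path_image (\<gamma> e') = pos ` (e \<inter> e'))"

definition drawing ::
  "'a set \<Rightarrow> 'a set set \<Rightarrow> ('a \<Rightarrow> complex) \<Rightarrow> ('a set \<Rightarrow> real \<Rightarrow> complex) \<Rightarrow> complex set" where
  "drawing V E pos \<gamma> = pos ` V \<union> (\<Union>e\<in>E. path_image (\<gamma> e))"

abbreviation outer_face :: "complex set \<Rightarrow> complex set" where
  "outer_face X \<equiv> outside X"

text \<open>
  The counterclockwise walk along the boundary of the outer face, as a closed curve of period
  \<open>2 * pi\<close>: the outer face of a connected drawing \<open>X\<close> is a topological annulus, swept out by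
  Jordan curves \<open>t \<mapsto> f (r * cis t)\<close>, \<open>r > 1\<close>, winding once counterclockwise around \<open>X\<close>;
  as \<open>r\<close> decreases to \<open>1\<close> these converge to the boundary walk \<open>\<beta>\<close>. Such an \<open>f\<close> exists by
  Caratheodory's theorem. It is unique up to a monotone change of the angle, so the cyclic
  order in which points are visited does not depend on \<open>f\<close>. The visits to a point \<open>p\<close> are the
  angles \<open>t\<close> modulo \<open>2 * pi\<close> with \<open>\<beta> t = p\<close>; a cut vertex is visited several times.
\<close>

definition outer_boundary_walk :: "complex set \<Rightarrow> (real \<Rightarrow> complex) \<Rightarrow> bool" where
  "outer_boundary_walk X \<beta> \<longleftrightarrow>
     (\<exists>f g. homeomorphism {z. 1 < norm z} (outer_face X) f g \<and>
            continuous_on {z. 1 \<le> norm z} f \<and>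
            (\<forall>r>1. \<forall>x\<in>X. winding_number (f \<circ> circlepath 0 r) x = 1) \<and>
            (\<forall>t. \<beta> t = f (cis t)))"

text \<open>
  One visit \<open>\<theta> i\<close> is fixed for every listed vertex; all of them lie within one turn of the
  walk, which may start anywhere.
\<close>

definition counterclockwise :: "(real \<Rightarrow> complex) \<Rightarrow> complex list \<Rightarrow> bool" where
  "counterclockwise \<beta> ps \<longleftrightarrow>
     (\<exists>\<theta> :: nat \<Rightarrow> real.
        strict_mono_on {..<length ps} \<theta> \<and>
        (\<forall>i<length ps. \<forall>j<length ps. \<theta> j < \<theta> i + 2 * pi) \<and>
        (\<forall>i<length ps. \<beta> (\<theta> i) = ps ! i))"


section \<open>Nodes and colorings\<close>

text \<open>
  \<open>Lower v\<close> and \<open>Upper v\<close> are the two copies of a doubled vertex \<open>v\<close>, in this order.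
\<close>

datatype 'a node = Single (vertex: 'a) | Lower (vertex: 'a) | Upper (vertex: 'a)

definition nodes :: "'a set \<Rightarrow> 'a set \<Rightarrow> 'a node set" where
  "nodes C1 C2 = Single ` C1 \<union> Lower ` C2 \<union> Upper ` C2"

definition node_list :: "'a set \<Rightarrow> 'a list \<Rightarrow> 'a node list" where
  "node_list D vs = concat (map (\<lambda>v. if v \<in> D then [Lower v, Upper v] else [Single v]) vs)"

text \<open>Indices start at 1, while list positions start at 0.\<close>

definition odd_nodes :: "'a node list \<Rightarrow> 'a node set" where
  "odd_nodes ns = {ns ! i | i. i < length ns \<and> odd (i + 1)}"

definition even_nodes :: "'a node list \<Rightarrow> 'a node set" where
  "even_nodes ns = {ns ! i | i. i < length ns \<and> even (i + 1)}"

definition sources :: "'a node list \<Rightarrow> 'a node set \<Rightarrow> 'a node set \<Rightarrow> 'a node set" where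
  "sources ns R B = (odd_nodes ns \<inter> B) \<union> (even_nodes ns \<inter> R)"

definition sinks :: "'a node list \<Rightarrow> 'a node set \<Rightarrow> 'a node set \<Rightarrow> 'a node set" where
  "sinks ns R B = (even_nodes ns \<inter> B) \<union> (odd_nodes ns \<inter> R)"

definition balanced :: "'a node list \<Rightarrow> 'a node set \<Rightarrow> 'a node set \<Rightarrow> bool" where
  "balanced ns R B \<longleftrightarrow> card (sources ns R B) = card (sinks ns R B)"

definition even_subsets :: "'b set \<Rightarrow> 'b set set" where
  "even_subsets N = {S. S \<subseteq> N \<and> even (card S)}"


section \<open>The Ashkin--Teller model\<close>

definition spins :: "'a set \<Rightarrow> ('a \<Rightarrow> real) set" where
  "spins V = V \<rightarrow>\<^sub>E {-1, 1}"

definition spin_prod :: "('a \<Rightarrow> real) \<Rightarrow> 'a set \<Rightarrow> real" where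
  "spin_prod \<sigma> A = (\<Prod>v\<in>A. \<sigma> v)"

text \<open>For an edge \<open>e = {u, v}\<close>, \<open>spin_prod \<sigma> e = \<sigma> u * \<sigma> v\<close>.\<close>

definition at_weight ::
  "'a set set \<Rightarrow> ('a set \<Rightarrow> real) \<Rightarrow> ('a set \<Rightarrow> real) \<Rightarrow> ('a \<Rightarrow> real) \<times> ('a \<Rightarrow> real) \<Rightarrow> real" where
  "at_weight E J U = (\<lambda>(\<sigma>, \<sigma>').
     \<Prod>e\<in>E. exp (J e * (spin_prod \<sigma> e + spin_prod \<sigma>' e)
                  + U e * (spin_prod \<sigma> e * spin_prod \<sigma>' e + 1)))"

definition at_partition ::
  "'a set \<Rightarrow> 'a set set \<Rightarrow> ('a set \<Rightarrow> real) \<Rightarrow> ('a set \<Rightarrow> real) \<Rightarrow> real" where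
  "at_partition V E J U = (\<Sum>\<omega> \<in> spins V \<times> spins V. at_weight E J U \<omega>)"

definition at_pmf ::
  "'a set \<Rightarrow> 'a set set \<Rightarrow> ('a set \<Rightarrow> real) \<Rightarrow> ('a set \<Rightarrow> real) \<Rightarrow> (('a \<Rightarrow> real) \<times> ('a \<Rightarrow> real)) pmf" where
  "at_pmf V E J U = embed_pmf (\<lambda>\<omega>.
     if \<omega> \<in> spins V \<times> spins V then at_weight E J U \<omega> / at_partition V E J U else 0)"

lemma finite_spins: "finite V \<Longrightarrow> finite (spins V)"
  by (simp add: spins_def finite_PiE)

lemma at_weight_pos: "at_weight E J U \<omega> > 0"
  by (auto simp: at_weight_def split: prod.split intro!: prod_pos)

lemma at_partition_pos:
  assumes "finite V"
  shows "at_partition V E J U > 0"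
proof -
  have "spins V \<noteq> {}"
    by (auto simp: spins_def PiE_eq_empty_iff)
  then show ?thesis
    unfolding at_partition_def
    using assms by (intro sum_pos) (auto simp: finite_spins at_weight_pos)
qed

lemma pmf_at_pmf:
  assumes "finite V"
  shows "pmf (at_pmf V E J U) \<omega> =
    (if \<omega> \<in> spins V \<times> spins V then at_weight E J U \<omega> / at_partition V E J U else 0)"
  unfolding at_pmf_def
proof (rule pmf_embed_pmf)
  let ?p = "\<lambda>\<omega>. if \<omega> \<in> spins V \<times> spins V
                then at_weight E J U \<omega> / at_partition V E J U else 0"
  have Z: "at_partition V E J U > 0"
    using assms by (rule at_partition_pos)
  show nonneg: "0 \<le> ?p \<omega>" for \<omega>
    using Z at_weight_pos[of E J U \<omega>] by simp
  have fin: "finite (spins V \<times> spins V)"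
    using assms by (simp add: finite_spins)
  have "(\<integral>\<^sup>+\<omega>. ennreal (?p \<omega>) \<partial>count_space UNIV) = (\<Sum>\<omega>\<in>spins V \<times> spins V. ennreal (?p \<omega>))"
    using fin by (intro nn_integral_count_space') auto
  also have "\<dots> = ennreal (\<Sum>\<omega>\<in>spins V \<times> spins V. ?p \<omega>)"
    by (intro sum_ennreal nonneg)
  also have "(\<Sum>\<omega>\<in>spins V \<times> spins V. ?p \<omega>) =
      (\<Sum>\<omega>\<in>spins V \<times> spins V. at_weight E J U \<omega> / at_partition V E J U)"
    by (intro sum.cong) auto
  also have "\<dots> = 1"
    using Z by (simp add: sum_divide_distrib[symmetric] at_partition_def[symmetric])
  finally show "(\<integral>\<^sup>+\<omega>. ennreal (?p \<omega>) \<partial>count_space UNIV) = 1"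
    by simp
qed

definition \<phi> :: "('a \<Rightarrow> real) \<Rightarrow> ('a \<Rightarrow> real) \<Rightarrow> 'a \<Rightarrow> real" where
  "\<phi> \<sigma> \<sigma>' v = (\<sigma> v + \<sigma>' v) / 2"

definition \<phi>' :: "('a \<Rightarrow> real) \<Rightarrow> ('a \<Rightarrow> real) \<Rightarrow> 'a \<Rightarrow> real" where
  "\<phi>' \<sigma> \<sigma>' v = (\<sigma> v - \<sigma>' v) / 2"

text \<open>Nodes are projected onto their vertices, so a doubled vertex may contribute two factors.\<close>

definition node_spin_prod :: "('a \<Rightarrow> real) \<Rightarrow> 'a node set \<Rightarrow> real" where
  "node_spin_prod \<sigma> S = (\<Prod>x\<in>S. \<sigma> (vertex x))"

end

theory Submission
  imports Defs "HOL-Library.Sublist"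
begin

text \<open>
  Given \<open>\<tau> = \<sigma> * \<sigma>'\<close>, the weight does not change when \<open>\<sigma>\<close> and \<open>\<sigma>'\<close> are
  both flipped on a connected component of the graph of those edges along which \<open>\<tau>\<close> is constant.
  If \<open>\<phi>\<close> and \<open>\<phi>'\<close> are nonzero at the prescribed vertices, these components are
  monochromatic, and by planarity they induce a noncrossing partition of the nodes. A
  noncrossing partition into blocks of even size always has two neighbouring nodes in the same
  block; such a pair contributes one source and one sink, and removing it does not change the parity
  of the other positions. Hence an unbalanced coloring forces a component with an odd number of
  nodes, and flipping it reverses the sign of the product.
\<close>

section \<open>Planarity\<close>

text \<open>Cancellation needs the flip to be an involution, so the component must be chosen from
  data that the flip preserves. \<open>\<tau>\<close> is such data: negating both spins on a set
  leaves their product unchanged.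

  A doubled vertex enters \<open>\<phi>\<close> or \<open>\<phi>'\<close> squared, and its two
  copies occupy neighbouring positions. It therefore affects neither the sign produced by a flip nor
  the excess of sources over sinks, and evenness of a component refers to its vertices in
  \<open>A1 \<union> B1\<close> alone.

  The topological difficulty is that the boundary walk may pass through a point several times, so
  crossing is not directly a statement about chords of a Jordan curve. The images under
  \<open>f\<close> of the circles of radius greater than 1 are simple curves, however, and winding
  numbers of loops running partly along such a curve detect the crossing.\<close>

lemma polar_inject:
  assumes "of_real r * cis s = of_real r' * cis t" "r > 0" "r' > 0" "\<bar>s - t\<bar> < 2 * pi"
  shows "r = r' \<and> s = t"
proof
  show r: "r = r'"
    using arg_cong[OF assms(1), of norm] assms(2,3) by (simp add: norm_mult)
  then have "cis s = cis t"
    using assms(1,2) by simp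
  then have "sin s = sin t \<and> cos s = cos t"
    by (simp add: complex_eq_iff)
  then obtain k :: int where k: "s = t + 2 * pi * k"
    using sin_cos_eq_iff by blast
  with assms(4) have "2 * pi * \<bar>k\<bar> < 2 * pi * 1"
    by (simp add: abs_mult)
  then have "\<bar>k\<bar> < 1"
    by (subst (asm) mult_less_cancel_left_pos) auto
  with k show "s = t"
    by simp
qed

lemma connected_unbounded_subset_outside:
  assumes "connected T" "\<not> bounded T" "T \<inter> S = {}"
  shows "T \<subseteq> outside S"
proof
  fix x assume "x \<in> T"
  then have "T \<subseteq> connected_component_set (- S) x"
    using assms by (intro connected_component_maximal) auto
  then show "x \<in> outside S"
    using assms bounded_subset unfolding outside by blast
qed

text \<open>Suppose that \<open>K1\<close> and \<open>K2\<close> are disjoint. Close up a path that runs along the ray at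
  angle \<open>a\<close>, through \<open>K1\<close> and back along the ray at angle \<open>c\<close> by either arc of the image of
  the circle of radius 2. The two loops have winding number 0 around a point on the ray at angle
  \<open>d\<close>: the first one because \<open>K2\<close> and the ray at angle \<open>b\<close> lead from there to infinity, the
  second one because the ray at angle \<open>d\<close> itself does. But the winding numbers differ by
  that of the circle, which is 1.\<close>

lemma boundary_walk_noncrossing:
  fixes f :: "complex \<Rightarrow> complex" and X K1 K2 :: "complex set"
  assumes "bounded X"
    and hom: "homeomorphism {z. 1 < norm z} (outside X) f g"
    and cont: "continuous_on {z. 1 \<le> norm z} f"
    and winding: "\<And>r x. r > 1 \<Longrightarrow> x \<in> X \<Longrightarrow> winding_number (f \<circ> circlepath 0 r) x = 1"
    and K: "K1 \<subseteq> X" "K2 \<subseteq> X"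
    and K1: "path_component K1 (f (cis a)) (f (cis c))"
    and K2: "path_component K2 (f (cis b)) (f (cis d))"
    and abcd: "a < b" "b < c" "c < d" "d < a + 2 * pi"
  shows "K1 \<inter> K2 \<noteq> {}"
proof
  assume disj: "K1 \<inter> K2 = {}"
  have inj: "inj_on f {z. 1 < norm z}"
    using hom by (intro inj_on_inverseI[of _ g]) (auto simp: homeomorphism_def)
  have img: "f ` {z. 1 < norm z} = outside X"
    using hom by (simp add: homeomorphism_image1)
  have disj_img: "f ` M \<inter> f ` M' = {}"
    if "M \<inter> M' = {}" "M \<subseteq> {z. 1 < norm z}" "M' \<subseteq> {z. 1 < norm z}" for M M'
    using that inj by (metis image_empty inj_on_image_Int)
  have disj_X: "f ` M \<inter> X = {}" if "M \<subseteq> {z. 1 < norm z}" for M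
    using that img outside_no_overlap by blast
  \<comment> \<open>Reduces the disjointness of two plane sets to that of their parameter sets
    outside the closed unit disc: images of parameters avoid \<open>X\<close>, hence both
    \<open>K1\<close> and \<open>K2\<close>, and these two are disjoint by assumption.\<close>
  have separated: "T \<inter> L = {}"
    if "T \<subseteq> f ` N \<union> K2" "L \<subseteq> K1 \<union> f ` M" "M \<inter> N = {}"
      "M \<subseteq> {z. 1 < norm z}" "N \<subseteq> {z. 1 < norm z}" for T L M N
  proof -
    have "f ` M \<inter> f ` N = {}" "f ` M \<inter> K2 = {}" "f ` N \<inter> K1 = {}"
      using disj_img[OF that(3-5)] disj_X[OF that(4)] disj_X[OF that(5)] K by auto
    with that(1,2) disj show ?thesis
      by blast
  qed
  have cont': "continuous_on S (\<lambda>x. f (h x))"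
    if "continuous_on S h" "\<And>x. x \<in> S \<Longrightarrow> 1 \<le> norm (h x)" for h and S :: "'b::topological_space set"
    using that by (intro continuous_on_compose2[OF cont]) auto
  define ray where "ray t = (\<lambda>r. f (of_real r * cis t))" for t
  have ray_path: "path (\<lambda>x. ray t (x + 1))" for t
    unfolding path_def ray_def by (intro cont' continuous_intros) (auto simp: norm_mult)
  have ray_ends: "pathstart (\<lambda>x. ray t (x + 1)) = f (cis t)" "pathfinish (\<lambda>x. ray t (x + 1)) = f (2 * cis t)" for t
    by (auto simp: pathstart_def pathfinish_def ray_def)
  \<comment> \<open>Injectivity of \<open>f\<close> is available only beyond radius 1. The endpoint
    at radius 1 is split off; on the rays in use it will be located in \<open>K1\<close> or
    \<open>K2\<close> instead.\<close>
  have ray_image: "ray t ` I \<subseteq> insert (f (cis t)) (f ` (\<lambda>r. of_real r * cis t) ` (I - {1}))" for t I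
  proof (rule image_subsetI)
    fix r assume "r \<in> I"
    then show "ray t r \<in> insert (f (cis t)) (f ` (\<lambda>r. of_real r * cis t) ` (I - {1}))"
      by (cases "r = 1") (auto simp: ray_def)
  qed
  have ray_path_image: "path_image (\<lambda>x. ray t (x + 1)) = ray t ` {1..2}" for t
    unfolding path_image_def image_image[symmetric, of "ray t" "\<lambda>x. x + 1"] by simp
  have ray_conn: "connected (ray t ` I)" if "connected I" "I \<subseteq> {1..}" for t I
    unfolding ray_def using that
    by (intro connected_continuous_image cont' continuous_intros) (auto simp: norm_mult)
  \<comment> \<open>A connected neighbourhood of infinity that stays off the image of the circle of
    radius 2; every escape route below ends in it.\<close>
  define far where "far = f ` {z. 2 < norm z}"
  have far_polar: "{z. 2 < norm z} = (\<lambda>(r, t). of_real r * cis t) ` ({2<..} \<times> UNIV)"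
  proof (intro equalityI subsetI)
    fix z :: complex assume "z \<in> {z. 2 < norm z}"
    then show "z \<in> (\<lambda>(r, t). of_real r * cis t) ` ({2<..} \<times> UNIV)"
      by (intro image_eqI[of _ _ "(norm z, Arg z)"]) (auto simp flip: rcis_def simp: rcis_cmod_Arg)
  qed (auto simp: norm_mult)
  have far_conn: "connected far"
    unfolding far_def far_polar image_image
    by (intro connected_continuous_image cont' convex_connected convex_Times)
       (auto simp: norm_mult case_prod_unfold intro!: continuous_intros)
  \<comment> \<open>The rest of the outer face is covered by the image of the compact annulus
    between radii 1 and 2, so all the unboundedness sits in \<open>far\<close>.\<close>
  have far_unb: "\<not> bounded far"
  proof
    assume "bounded far"
    moreover have "compact (f ` (cball 0 2 - ball 0 1))"
      by (intro compact_continuous_image continuous_on_subset[OF cont] compact_diff) auto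
    moreover have "outside X \<subseteq> far \<union> f ` (cball 0 2 - ball 0 1)"
      unfolding far_def img[symmetric] by force
    ultimately have "bounded (outside X)"
      by (meson bounded_Un bounded_subset compact_imp_bounded)
    with \<open>bounded X\<close> show False
      using unbounded_outside by blast
  qed
  obtain k where k: "path k" "path_image k \<subseteq> K1" "pathstart k = f (cis a)" "pathfinish k = f (cis c)"
    using K1 unfolding path_component_def by blast
  obtain k' where k': "path k'" "path_image k' \<subseteq> K2" "pathstart k' = f (cis b)" "pathfinish k' = f (cis d)"
    using K2 unfolding path_component_def by blast
  define P where "P = reversepath (\<lambda>x. ray a (x + 1)) +++ k +++ (\<lambda>x. ray c (x + 1))"
  define arc where "arc s t = (\<lambda>x. f (2 * cis (linepath s t x)))" for s t
  have arc: "path (arc s t)" "pathstart (arc s t) = f (2 * cis s)" "pathfinish (arc s t) = f (2 * cis t)"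
    for s t
    unfolding path_def arc_def pathstart_def pathfinish_def
    by (auto intro!: cont' continuous_intros simp: norm_mult linepath_def)
  have arc_image: "path_image (arc s t) = f ` (\<lambda>x. 2 * cis x) ` {s..t}" if "s \<le> t" for s t
  proof -
    have "path_image (arc s t) = f ` (\<lambda>x. 2 * cis x) ` path_image (linepath s t)"
      by (simp add: path_image_def arc_def image_image)
    then show ?thesis
      using that by (simp add: closed_segment_eq_real_ivl)
  qed
  have P: "path P" "pathstart P = f (2 * cis a)" "pathfinish P = f (2 * cis c)"
    unfolding P_def using k ray_path ray_ends by (auto intro!: path_join_imp)
  define legs where "legs = (\<lambda>r. of_real r * cis a) ` ({1..2} - {1}) \<union> (\<lambda>r. of_real r * cis c) ` ({1..2} - {1})"
  have P_image: "path_image P \<subseteq> K1 \<union> f ` legs"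
  proof -
    have in_K1: "f (cis a) \<in> K1" "f (cis c) \<in> K1"
      using k pathstart_in_path_image[of k] pathfinish_in_path_image[of k] by auto
    have "ray a ` {1..2} \<subseteq> K1 \<union> f ` legs"
      by (rule order.trans[OF ray_image]) (use in_K1 in \<open>simp add: legs_def image_Un le_supI2\<close>)
    moreover have "ray c ` {1..2} \<subseteq> K1 \<union> f ` legs"
      by (rule order.trans[OF ray_image]) (use in_K1 in \<open>simp add: legs_def image_Un le_supI2\<close>)
    ultimately show ?thesis
      unfolding P_def using k(2) by (intro subset_path_image_join) (auto simp: ray_path_image)
  qed
  \<comment> \<open>The arc that closes \<open>L1\<close> passes angle \<open>d\<close> and the one
    that closes \<open>L2\<close> passes angle \<open>b\<close>. Both loops contain \<open>P\<close>
    in the same direction, so its contribution cancels in the comparison.\<close>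
  define L1 L2 where "L1 = P +++ arc c (a + 2 * pi)" and "L2 = P +++ reversepath (arc a c)"
  have cis_period: "cis (a + 2 * pi) = cis a"
    by (simp add: complex_eq_iff)
  have L: "path L1" "pathfinish L1 = pathstart L1" "path L2" "pathfinish L2 = pathstart L2"
    unfolding L1_def L2_def using P arc cis_period by (auto intro!: path_join_imp)
  \<comment> \<open>Any radius strictly between 1 and 2 serves: \<open>q\<close> then lies in the
    outer face but inside the image of the circle of radius 2.\<close>
  obtain \<rho> :: real where \<rho>: "1 < \<rho>" "\<rho> < 2"
    using dense[of 1 "2 :: real"] by auto
  define q where "q = f (of_real \<rho> * cis d)"

  \<comment> \<open>A connected set that avoids the loop and joins \<open>q\<close> to
    \<open>far\<close> puts \<open>q\<close> in the outside of the loop.\<close>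
  have loop_zero: "winding_number l q = 0"
    if "path l" "pathfinish l = pathstart l" "connected T" "far \<subseteq> T" "q \<in> T" "T \<inter> path_image l = {}"
    for l T
    using that far_unb bounded_subset
    by (intro winding_number_zero_in_outside[OF that(1,2)] subsetD[OF connected_unbounded_subset_outside[of T]]) auto

  have L1: "winding_number L1 q = 0"
  proof (rule loop_zero)
    \<comment> \<open>\<open>L1\<close> blocks the ray at angle \<open>d\<close> at radius 2, so the
      route goes inwards to \<open>K2\<close>, through it, and out along the ray at angle
      \<open>b\<close>, which the closing arc avoids.\<close>
    define T1 where "T1 = far \<union> ray b ` {1..} \<union> path_image k' \<union> ray d ` {1..<2}"
    have "f (of_real 3 * cis b) \<in> far \<inter> ray b ` {1..}"
      by (auto simp: far_def ray_def norm_mult intro!: image_eqI[of _ _ 3])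
    moreover have "f (cis b) \<in> path_image k' \<inter> ray b ` {1..}"
      using k'(3) pathstart_in_path_image[of k'] by (auto simp: ray_def intro!: image_eqI[of _ _ 1])
    moreover have "f (cis d) \<in> path_image k' \<inter> ray d ` {1..<2}"
      using k'(4) pathfinish_in_path_image[of k'] by (auto simp: ray_def intro!: image_eqI[of _ _ 1])
    ultimately show "connected T1"
      unfolding T1_def using far_conn k'(1)
      by (intro connected_Un ray_conn connected_path_image) auto
    show "far \<subseteq> T1"
      by (auto simp: T1_def)
    show "q \<in> T1"
      unfolding T1_def q_def ray_def using \<rho> by (intro UnI2 imageI) auto
    define N where "N = {z. 2 < norm z} \<union> (\<lambda>r. of_real r * cis b) ` ({1..} - {1}) \<union>
      (\<lambda>r. of_real r * cis d) ` ({1..<2} - {1})"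
    have sub: "T1 \<subseteq> f ` N \<union> K2"
    proof -
      have in_K2: "f (cis b) \<in> K2" "f (cis d) \<in> K2"
        using k' pathstart_in_path_image[of k'] pathfinish_in_path_image[of k'] by auto
      have "ray b ` {1..} \<subseteq> f ` N \<union> K2"
        by (rule order.trans[OF ray_image]) (use in_K2 in \<open>simp add: N_def image_Un le_supI1 le_supI2\<close>)
      moreover have "ray d ` {1..<2} \<subseteq> f ` N \<union> K2"
        by (rule order.trans[OF ray_image]) (use in_K2 in \<open>simp add: N_def image_Un le_supI1 le_supI2\<close>)
      moreover have "far \<subseteq> f ` N"
        by (auto simp: far_def N_def)
      ultimately show ?thesis
        using k'(2) unfolding T1_def by blast
    qed
    define M where "M = legs \<union> (\<lambda>x. of_real 2 * cis x) ` {c..a + 2 * pi}"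
    have sub': "path_image L1 \<subseteq> K1 \<union> f ` M"
      using path_image_join_subset[of P "arc c (a + 2 * pi)"] P_image arc_image[of c "a + 2 * pi"] abcd
      unfolding L1_def M_def image_Un by auto
    have MN: "M \<subseteq> {z. 1 < norm z}" "N \<subseteq> {z. 1 < norm z}"
      by (auto simp: M_def N_def legs_def norm_mult)
    have "M \<inter> N = {}"
      using abcd by (auto simp: M_def N_def legs_def norm_mult dest!: polar_inject polar_inject[of 2, simplified])
    then show "T1 \<inter> path_image L1 = {}"
      by (rule separated[OF sub sub' _ MN])
  qed (use L in auto)
  have L2: "winding_number L2 q = 0"
  proof (rule loop_zero)
    \<comment> \<open>The arc from \<open>a\<close> to \<open>c\<close> does not pass angle
      \<open>d\<close>, so the ray itself leads to infinity. Starting it beyond radius 1 keeps it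
      away from \<open>K1\<close>.\<close>
    define T2 where "T2 = far \<union> ray d ` {1<..}"
    have "f (of_real 3 * cis d) \<in> far \<inter> ray d ` {1<..}"
      by (auto simp: far_def ray_def norm_mult intro!: image_eqI[of _ _ 3])
    then show "connected T2"
      unfolding T2_def using far_conn by (intro connected_Un ray_conn) auto
    show "far \<subseteq> T2"
      by (auto simp: T2_def)
    show "q \<in> T2"
      unfolding T2_def q_def ray_def using \<rho> by (intro UnI2 imageI) auto
    define N where "N = {z. 2 < norm z} \<union> (\<lambda>r. of_real r * cis d) ` {1<..}"
    have sub: "T2 \<subseteq> f ` N"
      unfolding T2_def N_def far_def ray_def by auto
    define M where "M = legs \<union> (\<lambda>x. of_real 2 * cis x) ` {a..c}"
    have sub': "path_image L2 \<subseteq> K1 \<union> f ` M"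
      using path_image_join_subset[of P "reversepath (arc a c)"] P_image arc_image[of a c] abcd
      unfolding L2_def M_def image_Un by auto
    have MN: "M \<subseteq> {z. 1 < norm z}" "N \<subseteq> {z. 1 < norm z}"
      by (auto simp: M_def N_def legs_def norm_mult)
    have "M \<inter> N = {}"
      using abcd by (auto simp: M_def N_def legs_def norm_mult dest!: polar_inject polar_inject[of 2, simplified])
    then show "T2 \<inter> path_image L2 = {}"
      by (rule separated[OF le_supI1[OF sub] sub' _ MN])
  qed (use L in auto)
  have q_arc: "q \<notin> f ` {z. norm z = 2}"
  proof -
    have "f ` {of_real \<rho> * cis d} \<inter> f ` {z. norm z = 2} = {}"
      by (rule disj_img) (use \<rho> in \<open>auto simp: norm_mult\<close>)
    then show ?thesis
      unfolding q_def by auto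
  qed
  have q_P: "q \<notin> path_image P"
  proof -
    have "f ` {of_real \<rho> * cis d} \<inter> f ` legs = {}"
      using abcd \<rho> by (intro disj_img) (auto simp: norm_mult legs_def dest!: polar_inject)
    moreover have "f ` {of_real \<rho> * cis d} \<inter> X = {}"
      using \<rho> by (intro disj_X) (auto simp: norm_mult)
    ultimately show ?thesis
      using P_image K unfolding q_def by auto
  qed
  have arc_circle: "path_image (arc s t) \<subseteq> f ` {z. norm z = 2}" for s t
    by (auto simp: arc_def path_image_def norm_mult)
  have q_arc': "q \<notin> path_image (arc s t)" for s t
    using q_arc arc_circle by blast
  have "winding_number L1 q = winding_number P q + winding_number (arc c (a + 2 * pi)) q"
    unfolding L1_def using P arc q_P q_arc' by (intro winding_number_join) auto
  moreover have "winding_number L2 q = winding_number P q + winding_number (reversepath (arc a c)) q"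
    unfolding L2_def using P arc q_P q_arc' by (intro winding_number_join) auto
  moreover have "winding_number (reversepath (arc a c)) q = - winding_number (arc a c) q"
    using arc q_arc' by (intro winding_number_reversepath)
  ultimately have sum0: "winding_number (arc a c) q + winding_number (arc c (a + 2 * pi)) q = 0"
    using L1 L2 by (simp add: eq_neg_iff_add_eq_0 algebra_simps)
  have "homotopic_loops (- {q}) (arc a c +++ arc c (a + 2 * pi)) (f \<circ> circlepath 0 2)"
  proof -
    define h where "h = linepath a c +++ linepath c (a + 2 * pi)"
    have "path h"
      unfolding h_def by (intro path_join_imp) auto
    then have h: "continuous_on {0..1} h"
      by (simp add: path_def)
    have h_ends: "h 0 = a" "h 1 = a + 2 * pi"
      by (simp_all add: h_def joinpaths_def linepath_def)
    have arcs: "(arc a c +++ arc c (a + 2 * pi)) = (\<lambda>x. f (2 * cis (h x)))"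
      by (auto simp: h_def arc_def joinpaths_def)
    have circ: "f \<circ> circlepath 0 2 = (\<lambda>x. f (2 * cis (2 * pi * x)))"
      by (auto simp: circlepath fun_eq_iff cis_conv_exp mult_ac)
    \<comment> \<open>The angles \<open>h x\<close> and \<open>2 * pi * x\<close> both gain
      \<open>2 * pi\<close> over the unit interval, so every interpolation between them gives a
      closed curve. All these curves stay on the image of the circle of radius 2, which misses
      \<open>q\<close>.\<close>
    define H where "H = (\<lambda>(s, x). f (2 * cis ((1 - s) * h x + s * (2 * pi * x))))"
    have "continuous_on ({0..1} \<times> {0..1}) H"
      unfolding H_def case_prod_unfold
      by (intro cont' continuous_intros continuous_on_compose2[OF h]) (auto simp: norm_mult)
    moreover have "H \<in> ({0..1} \<times> {0..1}) \<rightarrow> - {q}"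
    proof -
      have "f (2 * cis t) \<noteq> q" for t
        using q_arc by (metis (mono_tags, lifting) imageI mem_Collect_eq mult.right_neutral norm_cis norm_mult norm_numeral)
      then show ?thesis
        by (auto simp: H_def)
    qed
    moreover have "pathfinish (H \<circ> Pair s) = pathstart (H \<circ> Pair s)" for s
    proof -
      have "(1 - s) * (a + 2 * pi) + s * (2 * pi) = (1 - s) * a + 2 * pi"
        by (simp add: algebra_simps)
      then show ?thesis
        by (simp add: H_def pathfinish_def pathstart_def h_ends complex_eq_iff cis.ctr)
    qed
    ultimately show ?thesis
      unfolding homotopic_loops arcs circ by (intro exI[of _ H]) (auto simp: H_def)
  qed
  then have "winding_number (f \<circ> circlepath 0 2) q = winding_number (arc a c +++ arc c (a + 2 * pi)) q"
    by (simp add: winding_number_homotopic_loops)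
  also have "\<dots> = 0"
    using sum0 arc q_arc' by (subst winding_number_join) auto
  finally have "winding_number (f \<circ> circlepath 0 2) q = 0" .
  \<comment> \<open>The winding hypothesis concerns points of \<open>X\<close>. The piece of the ray
    below radius 2 carries \<open>q\<close> to \<open>f (cis d)\<close> in \<open>X\<close> without
    meeting the curve.\<close>
  moreover have "winding_number (f \<circ> circlepath 0 2) q = winding_number (f \<circ> circlepath 0 2) (f (cis d))"
  proof (rule winding_number_eq)
    show "path (f \<circ> circlepath 0 2)"
      unfolding path_def comp_def
      by (intro cont') (auto simp: circlepath norm_mult intro!: continuous_intros)
    show "pathfinish (f \<circ> circlepath 0 2) = pathstart (f \<circ> circlepath 0 2)"
      by (simp add: pathfinish_compose pathstart_compose)
    show "connected (ray d ` {1..<2})"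
      by (rule ray_conn) auto
    show "q \<in> ray d ` {1..<2}" 
      unfolding q_def ray_def using \<rho> by (intro imageI) auto
    show "f (cis d) \<in> ray d ` {1..<2}"
      by (auto simp: ray_def intro!: image_eqI[of _ _ 1])
    have "f (cis d) \<in> X"
      using k' K pathfinish_in_path_image by fastforce
    moreover have "f ` (\<lambda>r. of_real r * cis d) ` ({1..<2} - {1}) \<inter> f ` {z. norm z = 2} = {}"
      by (rule disj_img) (auto simp: norm_mult)
    moreover have "path_image (f \<circ> circlepath 0 2) \<subseteq> f ` {z. norm z = 2}"
      by (auto simp: path_image_compose)
    moreover have "f ` {z. norm z = 2} \<inter> X = {}"
      by (rule disj_X) auto
    ultimately show "ray d ` {1..<2} \<inter> path_image (f \<circ> circlepath 0 2) = {}"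
      using ray_image[of d "{1..<2}"] by (smt (verit) Int_iff disjoint_iff insert_iff subset_iff)
  qed
  moreover have "f (cis d) \<in> X"
    using k' K pathfinish_in_path_image by fastforce
  ultimately show False
    using winding[of 2 "f (cis d)"] by simp
qed

section \<open>Drawings of components in a plane graph\<close>

lemma plane_components_disjoint:
  assumes emb: "plane_embedding V E pos \<gamma>"
    and graph: "simple_graph V E"
    and C: "C \<subseteq> V" "C' \<subseteq> V" "C \<inter> C' = {}"
  shows "drawing C {e\<in>E. e \<subseteq> C} pos \<gamma> \<inter> drawing C' {e\<in>E. e \<subseteq> C'} pos \<gamma> = {}"
proof -
  have inj: "inj_on pos V"
    and vert: "\<And>e. e \<in> E \<Longrightarrow> path_image (\<gamma> e) \<inter> pos ` V = pos ` e"
    and edge: "\<And>e e'. e \<in> E \<Longrightarrow> e' \<in> E \<Longrightarrow> e \<noteq> e' \<Longrightarrow>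
      path_image (\<gamma> e) \<inter> path_image (\<gamma> e') = pos ` (e \<inter> e')"
    using emb unfolding plane_embedding_def by auto
  have vv: "pos ` D \<inter> pos ` D' = {}" if "D \<subseteq> V" "D' \<subseteq> V" "D \<inter> D' = {}" for D D'
    using inj_on_image_Int[OF inj that(1,2)] that(3) by simp
  \<comment> \<open>An arc meets vertex positions only at its own endpoints, so a common point would
    be the position of a common vertex.\<close>
  have ve: "pos ` D \<inter> path_image (\<gamma> e) = {}"
    if "e \<in> E" "D \<subseteq> V" "e \<subseteq> V" "D \<inter> e = {}" for D e
  proof -
    have "pos ` D \<inter> path_image (\<gamma> e) = pos ` D \<inter> (path_image (\<gamma> e) \<inter> pos ` V)"
      using image_mono[OF that(2), of pos] by blast
    then show ?thesis
      using vv[OF that(2-4)] vert[OF that(1)] by simp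
  qed
  have ee: "path_image (\<gamma> e) \<inter> path_image (\<gamma> e') = {}"
    if "e \<in> E" "e' \<in> E" "e \<inter> e' = {}" for e e'
  proof -
    have "e \<noteq> e'"
      using that graph by (auto simp: simple_graph_def)
    then show ?thesis
      using edge[OF that(1,2)] that(3) by simp
  qed
  have "pos ` C \<inter> pos ` C' = {}"
    using vv C by simp
  moreover have "pos ` C \<inter> (\<Union>e\<in>{e\<in>E. e \<subseteq> C'}. path_image (\<gamma> e)) = {}"
  proof -
    have "pos ` C \<inter> path_image (\<gamma> e) = {}" if "e \<in> E" "e \<subseteq> C'" for e
      using that C by (intro ve) auto
    then show ?thesis
      by auto
  qed
  moreover have "(\<Union>e\<in>{e\<in>E. e \<subseteq> C}. path_image (\<gamma> e)) \<inter> pos ` C' = {}"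
  proof -
    have "pos ` C' \<inter> path_image (\<gamma> e) = {}" if "e \<in> E" "e \<subseteq> C" for e
      using that C by (intro ve) auto
    then show ?thesis
      by auto
  qed
  moreover have "(\<Union>e\<in>{e\<in>E. e \<subseteq> C}. path_image (\<gamma> e)) \<inter> (\<Union>e\<in>{e\<in>E. e \<subseteq> C'}. path_image (\<gamma> e)) = {}"
  proof -
    have "path_image (\<gamma> e) \<inter> path_image (\<gamma> e') = {}" if "e \<in> E" "e \<subseteq> C" "e' \<in> E" "e' \<subseteq> C'" for e e'
      using that C by (intro ee) auto
    then show ?thesis
      by auto
  qed
  ultimately show ?thesis
    unfolding drawing_def Int_Un_distrib Int_Un_distrib2 by simp
qed

text \<open>Concatenates the arcs of the edges along an \<open>r\<close>-path; each of them lies in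
  the drawing of the subgraph induced on the component. That drawing may contain further arcs,
  namely of edges inside the component that do not come from \<open>r\<close>.\<close>

lemma path_component_drawing:
  assumes emb: "plane_embedding V E pos \<gamma>"
    and r: "r \<subseteq> {(x, y). {x, y} \<in> E}"
    and "(u, w) \<in> r\<^sup>*"
  shows "path_component (drawing (r\<^sup>* `` {u}) {e\<in>E. e \<subseteq> r\<^sup>* `` {u}} pos \<gamma>) (pos u) (pos w)"
  using assms(3)
proof (induction rule: rtrancl_induct)
  case base
  then show ?case
    by (auto intro!: path_component_refl simp: drawing_def)
next
  case (step x y)
  let ?C = "r\<^sup>* `` {u}" and ?e = "{x, y}"
  let ?K = "drawing ?C {e\<in>E. e \<subseteq> ?C} pos \<gamma>"
  have e: "?e \<in> E" "?e \<subseteq> ?C"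
    using step r by (auto intro: rtrancl.rtrancl_into_rtrancl)
  then have "path_image (\<gamma> ?e) \<subseteq> ?K"
    by (auto simp: drawing_def)
  moreover have "arc (\<gamma> ?e)" "{pathstart (\<gamma> ?e), pathfinish (\<gamma> ?e)} = {pos x, pos y}"
    using emb e(1) unfolding plane_embedding_def by auto
  ultimately have "path_component ?K (pathstart (\<gamma> ?e)) (pathfinish (\<gamma> ?e))"
    unfolding path_component_def using arc_imp_path by auto
  \<comment> \<open>The embedding does not say in which direction \<open>\<gamma>\<close> traverses
    the edge, so both orientations occur.\<close>
  then have "path_component ?K (pos x) (pos y)"
    using \<open>{pathstart (\<gamma> ?e), pathfinish (\<gamma> ?e)} = {pos x, pos y}\<close>
    by (auto simp: doubleton_eq_iff intro: path_component_sym)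
  with step.IH show ?case
    by (rule path_component_trans)
qed

lemma bounded_drawing:
  assumes "simple_graph V E" "plane_embedding V E pos \<gamma>"
  shows "bounded (drawing V E pos \<gamma>)"
proof -
  have "finite V" "E \<subseteq> Pow V"
    using assms(1) by (auto simp: simple_graph_def)
  then have "finite E"
    by (meson finite_Pow_iff finite_subset)
  moreover have "bounded (path_image (\<gamma> e))" if "e \<in> E" for e
    using assms(2) that by (auto simp: plane_embedding_def intro: bounded_path_image arc_imp_path)
  ultimately show ?thesis
    unfolding drawing_def using \<open>finite V\<close> by (auto intro: finite_imp_bounded)
qed

lemma component_subset:
  assumes graph: "simple_graph V E" and r: "r \<subseteq> {(x, y). {x, y} \<in> E}" and v: "v \<in> V"
  shows "r\<^sup>* `` {v} \<subseteq> V"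
proof
  fix w assume "w \<in> r\<^sup>* `` {v}"
  then have "(v, w) \<in> r\<^sup>*"
    by simp
  then show "w \<in> V"
    using v
  proof (induction rule: rtrancl_induct)
    case (step x y)
    then have "{x, y} \<subseteq> V"
      using r graph unfolding simple_graph_def by blast
    then show ?case
      by simp
  qed
qed

text \<open>Distinct components are disjoint, hence so are their drawings, which contradicts the
  crossing of two path-connected sets at alternating visits. The relation \<open>r\<close> will be
  the set of edges along which \<open>\<tau>\<close> is constant.\<close>

lemma plane_components_noncrossing:
  fixes \<theta> :: "nat \<Rightarrow> real"
  assumes graph: "simple_graph V E"
    and emb: "plane_embedding V E pos \<gamma>"
    and walk: "outer_boundary_walk (drawing V E pos \<gamma>) \<beta>"
    and r: "r \<subseteq> {(x, y). {x, y} \<in> E}" "sym r"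
    and u: "u1 \<in> V" "u2 \<in> V" "(u1, u3) \<in> r\<^sup>*" "(u2, u4) \<in> r\<^sup>*"
    and \<beta>: "\<beta> t1 = pos u1" "\<beta> t2 = pos u2" "\<beta> t3 = pos u3" "\<beta> t4 = pos u4"
    and t: "t1 < t2" "t2 < t3" "t3 < t4" "t4 < t1 + 2 * pi"
  shows "r\<^sup>* `` {u1} = r\<^sup>* `` {u2}"
proof -
  define K where "K C = drawing C {e\<in>E. e \<subseteq> C} pos \<gamma>" for C
  obtain f g where f: "homeomorphism {z. 1 < norm z} (outside (drawing V E pos \<gamma>)) f g"
    "continuous_on {z. 1 \<le> norm z} f"
    "\<And>r x. r > 1 \<Longrightarrow> x \<in> drawing V E pos \<gamma> \<Longrightarrow> winding_number (f \<circ> circlepath 0 r) x = 1"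
    "\<And>t. \<beta> t = f (cis t)"
    using walk unfolding outer_boundary_walk_def by auto
  have sub: "r\<^sup>* `` {v} \<subseteq> V" if "v \<in> V" for v
    using component_subset[OF graph r(1) that] .
  have K_sub: "K C \<subseteq> drawing V E pos \<gamma>" if "C \<subseteq> V" for C
    using that by (auto simp: K_def drawing_def)
  have "K (r\<^sup>* `` {u1}) \<inter> K (r\<^sup>* `` {u2}) \<noteq> {}"
  proof (rule boundary_walk_noncrossing[OF bounded_drawing[OF graph emb] f(1-3) _ _ _ _ t])
    show "K (r\<^sup>* `` {u1}) \<subseteq> drawing V E pos \<gamma>" "K (r\<^sup>* `` {u2}) \<subseteq> drawing V E pos \<gamma>"
      by (intro K_sub sub u)+
    show "path_component (K (r\<^sup>* `` {u1})) (f (cis t1)) (f (cis t3))"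
      using path_component_drawing[OF emb r(1) u(3)] by (simp add: K_def \<beta> flip: f(4))
    show "path_component (K (r\<^sup>* `` {u2})) (f (cis t2)) (f (cis t4))"
      using path_component_drawing[OF emb r(1) u(4)] by (simp add: K_def \<beta> flip: f(4))
  qed
  then have "r\<^sup>* `` {u1} \<inter> r\<^sup>* `` {u2} \<noteq> {}"
    using plane_components_disjoint[OF emb graph sub[OF u(1)] sub[OF u(2)]] unfolding K_def by blast
  then obtain w where w: "(u1, w) \<in> r\<^sup>*" "(u2, w) \<in> r\<^sup>*"
    by auto
  have "sym (r\<^sup>*)"
    using r(2) by (rule sym_rtrancl)
  with w have "(u1, u2) \<in> r\<^sup>*" "(u2, u1) \<in> r\<^sup>*"
    by (meson rtrancl_trans symD)+
  then show ?thesis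
    by (auto intro: rtrancl_trans)
qed

section \<open>Noncrossing partitions\<close>

text \<open>With \<open>c\<close> equal to 1 on blue and -1 on red nodes, this is the number of
  sources minus the number of sinks. The recursion makes the cancellation of two equal neighbours
  immediate.\<close>

fun alternating_sum :: "('b \<Rightarrow> int) \<Rightarrow> 'b list \<Rightarrow> int" where
  "alternating_sum c [] = 0"
| "alternating_sum c (x # xs) = c x - alternating_sum c xs"

lemma alternating_sum_append:
  "alternating_sum c (xs @ ys) = alternating_sum c xs + (-1) ^ length xs * alternating_sum c ys"
  by (induction xs) auto

lemma alternating_sum_map: "alternating_sum c (map g xs) = alternating_sum (c \<circ> g) xs"
  by (induction xs) auto

lemma alternating_sum_conv_sum:
  "alternating_sum c xs = (\<Sum>i<length xs. (-1) ^ i * c (xs ! i))"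
proof (induction xs)
  case (Cons x xs)
  then show ?case
    by (simp add: lessThan_Suc_eq_insert_0 sum.reindex sum_negf zero_notin_Suc_image del: sum.lessThan_Suc)
qed auto

lemma count_list_ge_2_decomp:
  assumes "count_list xs a \<ge> 2"
  shows "\<exists>u m w. xs = u @ a # m @ a # w"
proof -
  have "a \<in> set xs"
    using assms by (metis count_notin not_numeral_le_zero)
  then obtain u v where u: "xs = u @ a # v" "a \<notin> set u"
    by (meson split_list_first)
  with assms have "count_list v a \<noteq> 0"
    by auto
  then have "a \<in> set v"
    by (metis count_notin)
  then obtain m w where "v = m @ a # w"
    by (meson split_list)
  with u show ?thesis
    by blast
qed

text \<open>Lists without a subsequence \<open>a, b, a, b\<close> encode noncrossing partitions of their positions.\<close>

lemma noncrossing_adjacent_pair: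
  assumes "xs \<noteq> []"
    and even: "\<And>a. even (count_list xs a)"
    and noncrossing: "\<And>a b. a \<noteq> b \<Longrightarrow> \<not> subseq [a, b, a, b] xs"
  shows "\<exists>u a w. xs = u @ a # a # w"
proof -
  have twice: "count_list xs a \<ge> 2" if "a \<in> set xs" for a
  proof -
    have "count_list xs a \<noteq> 0"
      using that by (simp add: count_list_0_iff)
    moreover have "count_list xs a \<noteq> 1"
      using even[of a] by (metis odd_one)
    ultimately show ?thesis
      by linarith
  qed
  \<comment> \<open>Shrink the gap between two equal entries. The entry \<open>b\<close> that opens
    the gap occurs a second time, and an occurrence of \<open>b\<close> before or after the pair
    would be a crossing; so the second one lies in the gap and gives a shorter gap.\<close>
  have "\<exists>u a w. xs = u @ a # a # w" if "xs = u @ a # m @ a # w" for u a m w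
    using that
  proof (induction "length m" arbitrary: u a m w rule: less_induct)
    case less
    show ?case
    proof (cases m)
      case Nil
      with less.prems have "xs = u @ a # a # w"
        by simp
      then show ?thesis
        by blast
    next
      case (Cons b m')
      show ?thesis
      proof (cases "b = a")
        case True
        with less.prems Cons have "xs = u @ a # a # m' @ a # w"
          by simp
        then show ?thesis
          by blast
      next
        case False
        have "b \<notin> set u"
        proof
          assume "b \<in> set u"
          then obtain u1 u2 where "u = u1 @ b # u2"
            by (meson split_list)
          then have "xs = u1 @ b # u2 @ a # b # m' @ a # w"
            using less.prems Cons by simp
          then have "subseq [b, a, b, a] xs"
            by (simp only:) (intro list_emb_append2 subseq_Cons2 list_emb_Nil)
          with noncrossing[OF False] show False
            by contradiction
        qed
        moreover have "b \<notin> set w"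
        proof
          assume "b \<in> set w"
          then obtain w1 w2 where "w = w1 @ b # w2"
            by (meson split_list)
          then have "xs = u @ a # b # m' @ a # w1 @ b # w2"
            using less.prems Cons by simp
          then have "subseq [a, b, a, b] xs"
            by (simp only:) (intro list_emb_append2 subseq_Cons2 list_emb_Nil)
          with noncrossing[of a b] False show False
            by simp
        qed
        moreover have "count_list xs b \<ge> 2"
          using less.prems Cons by (intro twice) auto
        ultimately have "count_list m' b \<noteq> 0"
          using less.prems Cons False by (simp add: count_notin)
        then have "b \<in> set m'"
          by (metis count_notin)
        then obtain m1 m2 where "m' = m1 @ b # m2"
          by (meson split_list)
        then have "xs = (u @ [a]) @ b # m1 @ b # (m2 @ a # w)" "length m1 < length m"
          using less.prems Cons by auto
        then show ?thesis
          by (rule less.hyps[rotated])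
      qed
    qed
  qed
  moreover have "hd xs \<in> set xs"
    using assms(1) by simp
  ultimately show ?thesis
    using count_list_ge_2_decomp[OF twice, of "hd xs"] by blast
qed

text \<open>Entries stand for blocks, and \<open>c\<close> depends on the block alone. This encodes
  that blocks are monochromatic, and it is why equal neighbours cancel.\<close>

lemma noncrossing_alternating_sum:
  assumes "\<And>a. even (count_list xs a)"
    and "\<And>a b. a \<noteq> b \<Longrightarrow> \<not> subseq [a, b, a, b] xs"
  shows "alternating_sum c xs = 0"
  using assms
proof (induction "length xs" arbitrary: xs rule: less_induct)
  case less
  show ?case
  proof (cases "xs = []")
    case False
    then obtain u a w where xs: "xs = u @ a # a # w"
      using noncrossing_adjacent_pair less.prems by metis
    have "subseq (u @ w) xs"
      unfolding xs by (intro list_emb_append_mono subseq_order.refl) (meson list_emb_Cons subseq_order.refl)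
    then have "\<not> subseq [a, b, a, b] (u @ w)" if "a \<noteq> b" for a b
      using less.prems(2)[OF that] subseq_order.trans by blast
    moreover have "even (count_list (u @ w) b)" for b
      using less.prems(1)[of b] by (auto simp: xs split: if_splits)
    ultimately have "alternating_sum c (u @ w) = 0"
      using less.hyps[of "u @ w"] xs by simp
    then show ?thesis
      by (simp add: xs alternating_sum_append)
  qed simp
qed

text \<open>Supplies the positions at which the angles of the boundary walk are read off.\<close>

lemma subseq_four_nth:
  assumes "subseq [a, b, c, d] xs"
  obtains i j k l where "i < j" "j < k" "k < l" "l < length xs"
    "xs ! i = a" "xs ! j = b" "xs ! k = c" "xs ! l = d"
proof -
  from list_emb_ConsD[OF assms] obtain u r where u: "xs = u @ a # r" "subseq [b, c, d] r"
    by metis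
  from list_emb_ConsD[OF u(2)] obtain v s where v: "r = v @ b # s" "subseq [c, d] s"
    by metis
  from list_emb_ConsD[OF v(2)] obtain w t where w: "s = w @ c # t" "subseq [d] t"
    by metis
  from list_emb_ConsD[OF w(2)] obtain x y where x: "t = x @ d # y"
    by metis
  have xs: "xs = u @ a # v @ b # w @ c # x @ d # y"
    by (simp add: u v w x)
  show ?thesis
    by (rule that[of "length u" "length u + 1 + length v" "length u + 1 + length v + 1 + length w"
          "length u + 1 + length v + 1 + length w + 1 + length x"])
       (simp_all add: xs nth_append)
qed

section \<open>Sources and sinks as an alternating sum\<close>

lemma balanced_iff_alternating_sum:
  assumes "distinct ns" "set ns = R \<union> B" "R \<inter> B = {}"
  shows "balanced ns R B \<longleftrightarrow> alternating_sum (\<lambda>x. if x \<in> B then 1 else -1) ns = 0"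
proof -
  \<comment> \<open>Even list positions are odd indices, so \<open>?I\<close> holds the positions of
    the sources and \<open>?J\<close> those of the sinks.\<close>
  let ?I = "{i. i < length ns \<and> (even i \<longleftrightarrow> ns ! i \<in> B)}"
  let ?J = "{i. i < length ns \<and> \<not> (even i \<longleftrightarrow> ns ! i \<in> B)}"
  have R: "ns ! i \<in> R \<longleftrightarrow> ns ! i \<notin> B" if "i < length ns" for i
    using that assms(2,3) nth_mem[OF that] by auto
  have inj: "inj_on ((!) ns) I" if "I \<subseteq> {..<length ns}" for I
    using assms(1) that by (auto intro!: inj_on_nth)
  have "sources ns R B = (!) ns ` ?I"
    unfolding sources_def odd_nodes_def even_nodes_def using R by auto
  then have so: "card (sources ns R B) = card ?I"
    by (simp add: card_image inj subset_iff)
  have "sinks ns R B = (!) ns ` ?J"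
    unfolding sinks_def odd_nodes_def even_nodes_def using R by auto
  then have si: "card (sinks ns R B) = card ?J"
    by (simp add: card_image inj subset_iff)
  have "alternating_sum (\<lambda>x. if x \<in> B then 1 else -1) ns =
      (\<Sum>i<length ns. if even i \<longleftrightarrow> ns ! i \<in> B then 1 else -1)"
    unfolding alternating_sum_conv_sum by (intro sum.cong) auto
  also have "\<dots> = int (card ?I) - int (card ?J)"
  proof -
    have "?I = {..<length ns} \<inter> {i. even i \<longleftrightarrow> ns ! i \<in> B}" "?J = {..<length ns} \<inter> - {i. even i \<longleftrightarrow> ns ! i \<in> B}"
      by auto
    then show ?thesis
      by (simp only: sum.If_cases finite_lessThan) simp
  qed
  finally show ?thesis
    unfolding balanced_def so si by auto
qed

text \<open>The two copies of a doubled vertex are neighbours with equal values: they cancel, and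
  since they fill two positions they do not change any later sign.\<close>

lemma alternating_sum_node_list:
  "alternating_sum (c \<circ> vertex) (node_list D vs) = alternating_sum c (filter (\<lambda>v. v \<notin> D) vs)"
  by (induction vs) (auto simp: node_list_def)

lemma set_node_list: "set (node_list D vs) = nodes (set vs - D) (set vs \<inter> D)"
  by (auto simp: node_list_def nodes_def)

lemma distinct_node_list: "distinct vs \<Longrightarrow> distinct (node_list D vs)"
  by (induction vs) (auto simp: node_list_def)

lemma count_list_map_distinct:
  assumes "distinct xs"
  shows "count_list (map g xs) a = card {x \<in> set xs. g x = a}"
proof -
  have "count_list (map g xs) a = length (filter (\<lambda>x. g x = a) xs)"
    by (induction xs) auto
  then show ?thesis
    using assms by (simp add: distinct_card flip: set_filter)
qed

text \<open>Label each undoubled vertex by its component. Planarity makes the list of labels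
  noncrossing, \<open>even\<close> makes every label occur an even number of times, and
  \<open>mono\<close> lets the colour be read off the label, so the alternating sum of colours
  vanishes.\<close>

lemma balanced_of_even_components:
  assumes graph: "simple_graph V E"
    and emb: "plane_embedding V E pos \<gamma>"
    and walk: "outer_boundary_walk (drawing V E pos \<gamma>) \<beta>"
    and subset: "A1 \<union> A2 \<union> B1 \<union> B2 \<subseteq> V"
    and disjoint: "A1 \<inter> A2 = {}" "A1 \<inter> B1 = {}" "A1 \<inter> B2 = {}"
      "A2 \<inter> B1 = {}" "A2 \<inter> B2 = {}" "B1 \<inter> B2 = {}"
    and vs: "distinct vs" "set vs = A1 \<union> A2 \<union> B1 \<union> B2" "counterclockwise \<beta> (map pos vs)"
    and r: "r \<subseteq> {(x, y). {x, y} \<in> E}" "sym r"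
    and even: "\<And>v. v \<in> V \<Longrightarrow> even (card (r\<^sup>* `` {v} \<inter> (A1 \<union> B1)))"
    and mono: "\<And>u v. (u, v) \<in> r\<^sup>* \<Longrightarrow> u \<in> A1 \<union> A2 \<Longrightarrow> v \<notin> B1 \<union> B2"
  shows "balanced (node_list (A2 \<union> B2) vs) (nodes A1 A2) (nodes B1 B2)"
proof -
  define D where "D = A2 \<union> B2"
  define ss where "ss = filter (\<lambda>v. v \<notin> D) vs"
  define l where "l v = r\<^sup>* `` {v}" for v
  \<comment> \<open>The colour as a function of the component. Sets that meet neither colour class
    get -1 as well, but they are not labels of listed vertices.\<close>
  define c :: "'a set \<Rightarrow> int" where "c a = (if a \<inter> (B1 \<union> B2) \<noteq> {} then 1 else -1)" for a
  have sym: "sym (r\<^sup>*)"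
    using r(2) by (rule sym_rtrancl)
  have l_eq: "l u = l v \<longleftrightarrow> u \<in> l v" for u v
    unfolding l_def using sym by (auto intro: rtrancl_trans dest: symD)
  have c: "c (l v) = (if v \<in> B1 \<union> B2 then 1 else -1)" if "v \<in> set vs" for v
    using that mono[of v] vs(2) unfolding c_def l_def by auto
  have ss: "distinct ss" "set ss = A1 \<union> B1"
    using vs disjoint by (auto simp: ss_def D_def)
  obtain \<theta> where \<theta>: "strict_mono_on {..<length vs} \<theta>"
    "\<And>i j. i < length vs \<Longrightarrow> j < length vs \<Longrightarrow> \<theta> j < \<theta> i + 2 * pi"
    "\<And>i. i < length vs \<Longrightarrow> \<beta> (\<theta> i) = pos (vs ! i)"
    using vs(3) unfolding counterclockwise_def by auto
  have "alternating_sum c (map l ss) = 0"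
  proof (rule noncrossing_alternating_sum)
    fix a
    \<comment> \<open>A nonempty label class is the full trace of a component on
      \<open>A1 \<union> B1\<close>, which is the set that \<open>even\<close> speaks of.\<close>
    have "{v \<in> set ss. l v = a} = {} \<or> (\<exists>v\<in>V. {v \<in> set ss. l v = a} = l v \<inter> (A1 \<union> B1))"
      using ss(2) subset l_eq by blast
    then show "even (count_list (map l ss) a)"
      unfolding count_list_map_distinct[OF ss(1)]
      using even unfolding l_def[symmetric] by (elim disjE bexE; simp only: card.empty even_zero)
  next
    fix a b :: "'a set"
    assume "a \<noteq> b"
    show "\<not> subseq [a, b, a, b] (map l ss)"
    proof
      assume "subseq [a, b, a, b] (map l ss)"
      \<comment> \<open>The angles \<open>\<theta>\<close> are indexed by positions in
        \<open>vs\<close>, so the crossing is carried back to the list that includes the doubled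
        vertices.\<close>
      moreover have "subseq (map l ss) (map l vs)"
        unfolding ss_def by (intro subseq_map subseq_filter_left)
      ultimately have "subseq [a, b, a, b] (map l vs)"
        by (rule subseq_order.trans)
      then obtain i j k m where ijkm: "i < j" "j < k" "k < m" "m < length (map l vs)"
        and nth: "map l vs ! i = a" "map l vs ! j = b" "map l vs ! k = a" "map l vs ! m = b"
        by (rule subseq_four_nth)
      then have len: "i < length vs" "j < length vs" "k < length vs" "m < length vs"
        by auto
      have lab: "l (vs ! i) = a" "l (vs ! j) = b" "l (vs ! k) = a" "l (vs ! m) = b"
        using nth len by auto
      have "r\<^sup>* `` {vs ! i} = r\<^sup>* `` {vs ! j}"
      proof (rule plane_components_noncrossing[OF graph emb walk r])
        show "vs ! i \<in> V" "vs ! j \<in> V"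
          using len vs(2) subset nth_mem by blast+
        show "(vs ! i, vs ! k) \<in> r\<^sup>*" "(vs ! j, vs ! m) \<in> r\<^sup>*"
          using lab l_eq unfolding l_def by (metis Image_singleton_iff)+
        show "\<theta> i < \<theta> j" "\<theta> j < \<theta> k" "\<theta> k < \<theta> m"
          using \<theta>(1) ijkm len by (auto simp: strict_mono_on_def)
        show "\<theta> m < \<theta> i + 2 * pi"
          using \<theta>(2) len by blast
      qed (use \<theta>(3) len in auto)
      with lab \<open>a \<noteq> b\<close> show False
        by (simp add: l_def)
    qed
  qed
  then have zero: "alternating_sum ((c \<circ> l) \<circ> vertex) (node_list D vs) = 0"
    by (simp add: alternating_sum_node_list alternating_sum_map ss_def)
  have set_ns: "set (node_list D vs) = nodes A1 A2 \<union> nodes B1 B2"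
    unfolding set_node_list vs(2) D_def nodes_def using disjoint by blast
  have "alternating_sum ((c \<circ> l) \<circ> vertex) (node_list D vs) =
      alternating_sum (\<lambda>x. if x \<in> nodes B1 B2 then 1 else -1) (node_list D vs)"
    unfolding alternating_sum_conv_sum
  proof (intro sum.cong refl)
    fix i assume "i \<in> {..<length (node_list D vs)}"
    then have "node_list D vs ! i \<in> nodes A1 A2 \<union> nodes B1 B2"
      using set_ns nth_mem by blast
    then show "(-1) ^ i * ((c \<circ> l) \<circ> vertex) (node_list D vs ! i) =
        (-1) ^ i * (if node_list D vs ! i \<in> nodes B1 B2 then 1 else -1)"
      using c vs(2) disjoint by (auto simp: nodes_def)
  qed
  moreover have "nodes A1 A2 \<inter> nodes B1 B2 = {}"
    using disjoint by (auto simp: nodes_def)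
  ultimately show ?thesis
    using balanced_iff_alternating_sum[OF distinct_node_list[OF vs(1)], of D] set_ns zero
    by (simp add: D_def)
qed

section \<open>Ashkin--Teller correlations\<close>

lemma at_expectation:
  fixes f :: "('a \<Rightarrow> real) \<times> ('a \<Rightarrow> real) \<Rightarrow> real"
  assumes "finite V"
  shows "measure_pmf.expectation (at_pmf V E J U) f =
    (\<Sum>\<omega>\<in>spins V \<times> spins V. f \<omega> * at_weight E J U \<omega>) / at_partition V E J U"
proof -
  have "measure_pmf.expectation (at_pmf V E J U) f =
      (\<Sum>\<omega>\<in>spins V \<times> spins V. f \<omega> * pmf (at_pmf V E J U) \<omega>)"
    using assms by (intro integral_measure_pmf_real)
      (auto simp: finite_spins set_pmf_iff pmf_at_pmf split: if_splits)
  also have "\<dots> = (\<Sum>\<omega>\<in>spins V \<times> spins V. f \<omega> * at_weight E J U \<omega>) / at_partition V E J U"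
    unfolding sum_divide_distrib using assms by (intro sum.cong) (auto simp: pmf_at_pmf)
  finally show ?thesis .
qed

lemma at_expectation_sum:
  fixes f :: "'i \<Rightarrow> ('a \<Rightarrow> real) \<times> ('a \<Rightarrow> real) \<Rightarrow> real" and c :: "'i \<Rightarrow> real"
  assumes "finite V"
  shows "measure_pmf.expectation (at_pmf V E J U) (\<lambda>\<omega>. \<Sum>i\<in>I. c i * f i \<omega>) =
    (\<Sum>i\<in>I. c i * measure_pmf.expectation (at_pmf V E J U) (f i))"
proof -
  have "(\<Sum>\<omega>\<in>spins V \<times> spins V. (\<Sum>i\<in>I. c i * f i \<omega>) * at_weight E J U \<omega>) =
      (\<Sum>i\<in>I. \<Sum>\<omega>\<in>spins V \<times> spins V. c i * f i \<omega> * at_weight E J U \<omega>)"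
    unfolding sum_distrib_right by (rule sum.swap)
  then show ?thesis
    unfolding at_expectation[OF assms] by (simp add: sum_divide_distrib sum_distrib_left mult.assoc)
qed

text \<open>The terms at \<open>\<omega>\<close> and \<open>T \<omega>\<close> cancel. Fixed points
  of \<open>T\<close> are harmless, because \<open>neg\<close> forces \<open>f\<close> to vanish
  there.\<close>

lemma at_expectation_involution_eq_0:
  fixes f :: "('a \<Rightarrow> real) \<times> ('a \<Rightarrow> real) \<Rightarrow> real"
  assumes V: "finite V"
    and T: "\<And>\<omega>. \<omega> \<in> spins V \<times> spins V \<Longrightarrow> T \<omega> \<in> spins V \<times> spins V"
      "\<And>\<omega>. \<omega> \<in> spins V \<times> spins V \<Longrightarrow> T (T \<omega>) = \<omega>"
    and weight: "\<And>\<omega>. \<omega> \<in> spins V \<times> spins V \<Longrightarrow> at_weight E J U (T \<omega>) = at_weight E J U \<omega>"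
    and neg: "\<And>\<omega>. \<omega> \<in> spins V \<times> spins V \<Longrightarrow> f (T \<omega>) = - f \<omega>"
  shows "measure_pmf.expectation (at_pmf V E J U) f = 0"
proof -
  let ?S = "\<Sum>\<omega>\<in>spins V \<times> spins V. f \<omega> * at_weight E J U \<omega>"
  have "?S = (\<Sum>\<omega>\<in>spins V \<times> spins V. f (T \<omega>) * at_weight E J U (T \<omega>))"
    by (rule sum.reindex_bij_witness[of _ T T]) (use T in auto)
  also have "\<dots> = - ?S"
    unfolding sum_negf[symmetric] by (intro sum.cong) (simp_all add: weight neg)
  finally show ?thesis
    unfolding at_expectation[OF V] by simp
qed

section \<open>Symmetries of the weight under spin flips\<close>

definition flip :: "'a set \<Rightarrow> ('a \<Rightarrow> real) \<Rightarrow> 'a \<Rightarrow> real" where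
  "flip C \<sigma> = (\<lambda>v. if v \<in> C then - \<sigma> v else \<sigma> v)"

lemma flip_flip [simp]: "flip C (flip C \<sigma>) = \<sigma>"
  by (auto simp: flip_def)

lemma flip_in_spins: "\<sigma> \<in> spins V \<Longrightarrow> C \<subseteq> V \<Longrightarrow> flip C \<sigma> \<in> spins V"
  by (auto simp: spins_def flip_def PiE_iff extensional_def)

lemma spins_values: "\<sigma> \<in> spins V \<Longrightarrow> v \<in> V \<Longrightarrow> \<sigma> v = 1 \<or> \<sigma> v = -1"
  by (auto simp: spins_def)

text \<open>Covers both sources of signs: spins flipped on a set, and the minus sign of the second
  spin at blue nodes.\<close>

lemma prod_flip_sign:
  fixes f :: "'a \<Rightarrow> real"
  assumes "finite A"
  shows "(\<Prod>v\<in>A. if v \<in> C then - f v else f v) = (-1) ^ card (A \<inter> C) * (\<Prod>v\<in>A. f v)"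
proof -
  have "(\<Prod>v\<in>A. if v \<in> C then - f v else f v) = (\<Prod>v\<in>A. (if v \<in> C then -1 else 1) * f v)"
    by (intro prod.cong) auto
  also have "\<dots> = (\<Prod>v\<in>A. if v \<in> C then -1 else 1) * (\<Prod>v\<in>A. f v)"
    by (rule prod.distrib)
  finally show ?thesis
    using assms by (simp add: prod.If_cases Int_def)
qed

lemma spin_prod_flip:
  "finite e \<Longrightarrow> spin_prod (flip C \<sigma>) e = (-1) ^ card (e \<inter> C) * spin_prod \<sigma> e"
  unfolding spin_prod_def flip_def by (rule prod_flip_sign)

text \<open>On an edge leaving \<open>C\<close> the spin products of \<open>\<sigma>\<close> and \<open>\<sigma>'\<close> are
  opposite. The flip negates both, which preserves their vanishing sum and their product.\<close>

lemma at_weight_flip_components: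
  assumes graph: "simple_graph V E" and \<sigma>: "\<sigma> \<in> spins V" "\<sigma>' \<in> spins V"
    and closed: "\<And>u v. {u, v} \<in> E \<Longrightarrow> u \<in> C \<Longrightarrow> v \<notin> C \<Longrightarrow> \<sigma> u * \<sigma>' u \<noteq> \<sigma> v * \<sigma>' v"
  shows "at_weight E J U (flip C \<sigma>, flip C \<sigma>') = at_weight E J U (\<sigma>, \<sigma>')"
  unfolding at_weight_def prod.case
proof (intro prod.cong refl arg_cong[of _ _ exp])
  fix e assume "e \<in> E"
  then obtain u v where e: "e = {u, v}" "u \<noteq> v" and uv: "u \<in> V" "v \<in> V"
    using graph unfolding simple_graph_def card_2_iff by fast
  have eE: "{u, v} \<in> E" "{v, u} \<in> E"
    using \<open>e \<in> E\<close> e by (auto simp: insert_commute)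
  have vals: "\<sigma> u = 1 \<or> \<sigma> u = -1" "\<sigma> v = 1 \<or> \<sigma> v = -1" "\<sigma>' u = 1 \<or> \<sigma>' u = -1" "\<sigma>' v = 1 \<or> \<sigma>' v = -1"
    using \<sigma> uv spins_values by metis+
  show "J e * (spin_prod (flip C \<sigma>) e + spin_prod (flip C \<sigma>') e) +
        U e * (spin_prod (flip C \<sigma>) e * spin_prod (flip C \<sigma>') e + 1) =
      J e * (spin_prod \<sigma> e + spin_prod \<sigma>' e) + U e * (spin_prod \<sigma> e * spin_prod \<sigma>' e + 1)"
  proof (cases "u \<in> C \<longleftrightarrow> v \<in> C")
    case True
    then show ?thesis
      using e by (auto simp: spin_prod_def flip_def)
  next
    case False
    then have "\<sigma> u * \<sigma>' u \<noteq> \<sigma> v * \<sigma>' v"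
      using closed[OF eE(1)] closed[OF eE(2)] by auto
    then have "\<sigma>' u * \<sigma>' v = - (\<sigma> u * \<sigma> v)"
      using vals by auto
    with False show ?thesis
      using e by (auto simp: spin_prod_def flip_def)
  qed
qed

text \<open>Each edge has both of its endpoints in \<open>V\<close>, so two signs cancel. This
  global symmetry removes the odd subsets from the expansion.\<close>

lemma at_weight_flip_second:
  assumes "simple_graph V E"
  shows "at_weight E J U (\<sigma>, flip V \<sigma>') = at_weight E J U (\<sigma>, \<sigma>')"
proof -
  have "spin_prod (flip V \<sigma>') e = spin_prod \<sigma>' e" if "e \<in> E" for e
  proof -
    have "finite e" "e \<inter> V = e" "card e = 2"
      using assms that by (auto simp: simple_graph_def intro: card_ge_0_finite)
    then show ?thesis
      by (simp add: spin_prod_flip)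
  qed
  then show ?thesis
    unfolding at_weight_def prod.case by (intro prod.cong) auto
qed

lemma phi_flip:
  "\<phi> (flip C \<sigma>) (flip C \<sigma>') v = (if v \<in> C then - \<phi> \<sigma> \<sigma>' v else \<phi> \<sigma> \<sigma>' v)"
  "\<phi>' (flip C \<sigma>) (flip C \<sigma>') v = (if v \<in> C then - \<phi>' \<sigma> \<sigma>' v else \<phi>' \<sigma> \<sigma>' v)"
  by (auto simp: \<phi>_def \<phi>'_def flip_def field_simps)

definition phi_prod ::
  "'a set \<Rightarrow> 'a set \<Rightarrow> 'a set \<Rightarrow> 'a set \<Rightarrow> ('a \<Rightarrow> real) \<times> ('a \<Rightarrow> real) \<Rightarrow> real" where
  "phi_prod A1 A2 B1 B2 = (\<lambda>(\<sigma>, \<sigma>').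
     (\<Prod>v\<in>A1. \<phi> \<sigma> \<sigma>' v) * (\<Prod>v\<in>A2. (\<phi> \<sigma> \<sigma>' v)\<^sup>2) *
     (\<Prod>v\<in>B1. \<phi>' \<sigma> \<sigma>' v) * (\<Prod>v\<in>B2. (\<phi>' \<sigma> \<sigma>' v)\<^sup>2))"

text \<open>Each vertex of \<open>A1 \<union> B1\<close> in \<open>C\<close> contributes one sign;
  at doubled vertices the square absorbs it.\<close>

lemma phi_prod_flip:
  assumes "finite A1" "finite B1" "A1 \<inter> B1 = {}"
  shows "phi_prod A1 A2 B1 B2 (flip C \<sigma>, flip C \<sigma>') =
    (-1) ^ card ((A1 \<union> B1) \<inter> C) * phi_prod A1 A2 B1 B2 (\<sigma>, \<sigma>')"
proof -
  have "card ((A1 \<union> B1) \<inter> C) = card (A1 \<inter> C) + card (B1 \<inter> C)"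
    unfolding Int_Un_distrib2 using assms by (intro card_Un_disjoint) auto
  moreover have "(\<Prod>v\<in>A2. (\<phi> (flip C \<sigma>) (flip C \<sigma>') v)\<^sup>2) = (\<Prod>v\<in>A2. (\<phi> \<sigma> \<sigma>' v)\<^sup>2)"
    "(\<Prod>v\<in>B2. (\<phi>' (flip C \<sigma>) (flip C \<sigma>') v)\<^sup>2) = (\<Prod>v\<in>B2. (\<phi>' \<sigma> \<sigma>' v)\<^sup>2)"
    by (intro prod.cong; simp add: phi_flip)+
  ultimately show ?thesis
    using assms(1,2) by (simp add: phi_prod_def phi_flip prod_flip_sign power_add)
qed

lemma phi_prod_expectation_eq_0:
  assumes graph: "simple_graph V E"
    and emb: "plane_embedding V E pos \<gamma>"
    and walk: "outer_boundary_walk (drawing V E pos \<gamma>) \<beta>"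
    and subset: "A1 \<union> A2 \<union> B1 \<union> B2 \<subseteq> V"
    and disjoint: "A1 \<inter> A2 = {}" "A1 \<inter> B1 = {}" "A1 \<inter> B2 = {}"
      "A2 \<inter> B1 = {}" "A2 \<inter> B2 = {}" "B1 \<inter> B2 = {}"
    and vs: "distinct vs" "set vs = A1 \<union> A2 \<union> B1 \<union> B2" "counterclockwise \<beta> (map pos vs)"
    and unbalanced: "\<not> balanced (node_list (A2 \<union> B2) vs) (nodes A1 A2) (nodes B1 B2)"
  shows "measure_pmf.expectation (at_pmf V E J U) (phi_prod A1 A2 B1 B2) = 0"
proof -
  have V: "finite V"
    using graph by (simp add: simple_graph_def)
  have fin: "finite A1" "finite A2" "finite B1" "finite B2"
    using finite_subset[OF subset V] by auto
  define r where "r \<tau> = {(x, y). {x, y} \<in> E \<and> \<tau> x = \<tau> y}" for \<tau> :: "'a \<Rightarrow> real"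
  define odd_at where "odd_at \<tau> v \<longleftrightarrow> v \<in> V \<and> odd (card ((r \<tau>)\<^sup>* `` {v} \<inter> (A1 \<union> B1)))" for \<tau> v
  \<comment> \<open>The choice depends on \<open>\<tau>\<close> alone. If no component is odd, the
    default \<open>{}\<close> turns the flip into the identity, and the product then has to vanish
    by itself.\<close>
  define C where "C \<tau> = (if \<exists>v. odd_at \<tau> v then (r \<tau>)\<^sup>* `` {SOME v. odd_at \<tau> v} else {})" for \<tau>
  define T where "T = (\<lambda>(\<sigma>, \<sigma>'). (flip (C (\<lambda>v. \<sigma> v * \<sigma>' v)) \<sigma>, flip (C (\<lambda>v. \<sigma> v * \<sigma>' v)) \<sigma>'))"
  have r: "r \<tau> \<subseteq> {(x, y). {x, y} \<in> E}" "sym (r \<tau>)" for \<tau>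
    by (auto simp: r_def sym_def insert_commute)
  have some_odd: "odd_at \<tau> (SOME v. odd_at \<tau> v)" if "odd_at \<tau> v" for \<tau> v
    using that by (rule someI)
  have C_sub: "C \<tau> \<subseteq> V" for \<tau>
  proof -
    have "(SOME v. odd_at \<tau> v) \<in> V" if "\<exists>v. odd_at \<tau> v"
      using that some_odd unfolding odd_at_def by blast
    then show ?thesis
      unfolding C_def using component_subset[OF graph r(1)] by simp
  qed
  have C_closed: "\<tau> u \<noteq> \<tau> v" if "{u, v} \<in> E" "u \<in> C \<tau>" "v \<notin> C \<tau>" for \<tau> u v
  proof
    assume "\<tau> u = \<tau> v"
    with that(1) have "(u, v) \<in> r \<tau>"
      by (simp add: r_def)
    with that(2,3) show False
      by (auto simp: C_def split: if_splits intro: rtrancl.rtrancl_into_rtrancl)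
  qed
  show ?thesis
  proof (rule at_expectation_involution_eq_0[OF V])
    fix \<omega> :: "('a \<Rightarrow> real) \<times> ('a \<Rightarrow> real)"
    assume "\<omega> \<in> spins V \<times> spins V"
    then obtain \<sigma> \<sigma>' where \<omega>: "\<omega> = (\<sigma>, \<sigma>')" and \<sigma>: "\<sigma> \<in> spins V" "\<sigma>' \<in> spins V"
      by auto
    define \<tau> where "\<tau> = (\<lambda>v. \<sigma> v * \<sigma>' v)"
    have T: "T \<omega> = (flip (C \<tau>) \<sigma>, flip (C \<tau>) \<sigma>')"
      by (simp add: T_def \<omega> \<tau>_def)
    show "T \<omega> \<in> spins V \<times> spins V"
      unfolding T using C_sub \<sigma> by (auto intro: flip_in_spins)
    have "(\<lambda>v. flip (C \<tau>) \<sigma> v * flip (C \<tau>) \<sigma>' v) = \<tau>"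
      by (auto simp: flip_def \<tau>_def)
    then show "T (T \<omega>) = \<omega>"
      unfolding T by (simp add: T_def \<omega>)
    show "at_weight E J U (T \<omega>) = at_weight E J U \<omega>"
      unfolding T unfolding \<omega> using C_closed[of _ _ \<tau>]
      by (intro at_weight_flip_components[OF graph \<sigma>]) (auto simp: \<tau>_def)
    show "phi_prod A1 A2 B1 B2 (T \<omega>) = - phi_prod A1 A2 B1 B2 \<omega>"
    proof (cases "\<exists>v. odd_at \<tau> v")
      case True
      then have "C \<tau> = (r \<tau>)\<^sup>* `` {SOME v. odd_at \<tau> v}" "odd_at \<tau> (SOME v. odd_at \<tau> v)"
        using some_odd by (auto simp: C_def)
      then have "odd (card ((A1 \<union> B1) \<inter> C \<tau>))"
        by (metis Int_commute odd_at_def)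
      then show ?thesis
        unfolding T unfolding \<omega> phi_prod_flip[OF fin(1,3) disjoint(2)] by simp
    next
      case False
      \<comment> \<open>A nonzero value would fix \<open>\<tau>\<close> as 1 on red and -1 on blue
        vertices. Components would be monochromatic and, in this case, even, so the coloring would
        be balanced.\<close>
      have "phi_prod A1 A2 B1 B2 \<omega> = 0"
      proof (rule ccontr)
        assume nz: "phi_prod A1 A2 B1 B2 \<omega> \<noteq> 0"
        have A: "\<tau> v = 1" if "v \<in> A1 \<union> A2" for v
        proof -
          have "\<sigma> v + \<sigma>' v \<noteq> 0"
            using nz that fin by (auto simp: phi_prod_def \<omega> \<phi>_def)
          moreover have "v \<in> V"
            using that subset by auto
          ultimately show ?thesis
            using spins_values[OF \<sigma>(1)] spins_values[OF \<sigma>(2)] by (fastforce simp: \<tau>_def)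
        qed
        have B: "\<tau> v = -1" if "v \<in> B1 \<union> B2" for v
        proof -
          have "\<sigma> v - \<sigma>' v \<noteq> 0"
            using nz that fin by (auto simp: phi_prod_def \<omega> \<phi>'_def)
          moreover have "v \<in> V"
            using that subset by auto
          ultimately show ?thesis
            using spins_values[OF \<sigma>(1)] spins_values[OF \<sigma>(2)] by (fastforce simp: \<tau>_def)
        qed
        have const: "\<tau> u = \<tau> v" if "(u, v) \<in> (r \<tau>)\<^sup>*" for u v
          using that by (induction rule: rtrancl_induct) (auto simp: r_def)
        have "balanced (node_list (A2 \<union> B2) vs) (nodes A1 A2) (nodes B1 B2)"
        proof (rule balanced_of_even_components[OF graph emb walk subset disjoint vs r[of \<tau>]])
          show "even (card ((r \<tau>)\<^sup>* `` {v} \<inter> (A1 \<union> B1)))" if "v \<in> V" for v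
            using False that by (auto simp: odd_at_def)
          show "v \<notin> B1 \<union> B2" if "(u, v) \<in> (r \<tau>)\<^sup>*" "u \<in> A1 \<union> A2" for u v
            using const[OF that(1)] A[OF that(2)] B[of v] by auto
        qed
        with unbalanced show False
          by contradiction
      qed
      then show ?thesis
        unfolding T unfolding \<omega> phi_prod_flip[OF fin(1,3) disjoint(2)] by simp
    qed
  qed
qed

section \<open>Expansion of the product over the nodes\<close>

lemma prod_nodes:
  assumes "finite C1" "finite C2"
  shows "(\<Prod>x\<in>nodes C1 C2. g x) = (\<Prod>v\<in>C1. g (Single v)) * (\<Prod>v\<in>C2. g (Lower v) * g (Upper v))"
proof -
  have "(\<Prod>x\<in>nodes C1 C2. g x) =
      (\<Prod>x\<in>Single ` C1. g x) * (\<Prod>x\<in>Lower ` C2. g x) * (\<Prod>x\<in>Upper ` C2. g x)"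
    unfolding nodes_def using assms by (subst prod.union_disjoint; auto)+
  moreover have "(\<Prod>x\<in>Single ` C1. g x) = (\<Prod>v\<in>C1. g (Single v))"
    "(\<Prod>x\<in>Lower ` C2. g x) = (\<Prod>v\<in>C2. g (Lower v))"
    "(\<Prod>x\<in>Upper ` C2. g x) = (\<Prod>v\<in>C2. g (Upper v))"
    by (subst prod.reindex; auto simp: inj_on_def)+
  ultimately show ?thesis
    by (simp add: prod.distrib mult.assoc)
qed

lemma finite_nodes: "finite C1 \<Longrightarrow> finite C2 \<Longrightarrow> finite (nodes C1 C2)"
  by (simp add: nodes_def)

text \<open>Write the product with one factor half of (first spin plus or minus second spin) per
  node, the two copies of a doubled vertex accounting for its square, and multiply out.
  \<open>S\<close> collects the nodes at which the second spin is taken, with a minus sign at the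
  blue ones.\<close>

lemma phi_prod_expand:
  assumes fin: "finite A1" "finite A2" "finite B1" "finite B2"
    and disjoint: "nodes A1 A2 \<inter> nodes B1 B2 = {}"
    and N: "N = nodes A1 A2 \<union> nodes B1 B2"
  shows "phi_prod A1 A2 B1 B2 (\<sigma>, \<sigma>') = 1 / 2 ^ card N *
    (\<Sum>S\<in>Pow N. (-1) ^ card (S \<inter> nodes B1 B2) * (node_spin_prod \<sigma> (N - S) * node_spin_prod \<sigma>' S))"
proof -
  let ?R = "nodes A1 A2" and ?B = "nodes B1 B2"
  let ?s = "\<lambda>x. if x \<in> ?B then - \<sigma>' (vertex x) else \<sigma>' (vertex x)"
  have finN: "finite ?R" "finite ?B" "finite N"
    using fin N by (simp_all add: finite_nodes)
  have "phi_prod A1 A2 B1 B2 (\<sigma>, \<sigma>') =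
      (\<Prod>x\<in>?R. \<phi> \<sigma> \<sigma>' (vertex x)) * (\<Prod>x\<in>?B. \<phi>' \<sigma> \<sigma>' (vertex x))"
    using fin by (simp add: phi_prod_def prod_nodes power2_eq_square mult_ac)
  also have "\<dots> = (\<Prod>x\<in>N. (?s x + \<sigma> (vertex x)) / 2)"
    unfolding N prod.union_disjoint[OF finN(1,2) disjoint]
    using disjoint by (intro arg_cong2[of _ _ _ _ "(*)"] prod.cong) (auto simp: \<phi>_def \<phi>'_def)
  also have "\<dots> = 1 / 2 ^ card N * (\<Prod>x\<in>N. ?s x + \<sigma> (vertex x))"
    by (simp add: prod_dividef)
  also have "(\<Prod>x\<in>N. ?s x + \<sigma> (vertex x)) = (\<Sum>S\<in>Pow N. (\<Prod>x\<in>S. ?s x) * (\<Prod>x\<in>N - S. \<sigma> (vertex x)))"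
    by (rule prod_add[OF finN(3)])
  also have "\<dots> = (\<Sum>S\<in>Pow N. (-1) ^ card (S \<inter> ?B) * (node_spin_prod \<sigma> (N - S) * node_spin_prod \<sigma>' S))"
  proof (intro sum.cong refl)
    fix S assume "S \<in> Pow N"
    then have "finite S"
      using finN(3) finite_subset by auto
    then have "(\<Prod>x\<in>S. ?s x) = (-1) ^ card (S \<inter> ?B) * node_spin_prod \<sigma>' S"
      unfolding node_spin_prod_def by (rule prod_flip_sign)
    then show "(\<Prod>x\<in>S. ?s x) * (\<Prod>x\<in>N - S. \<sigma> (vertex x)) =
        (-1) ^ card (S \<inter> ?B) * (node_spin_prod \<sigma> (N - S) * node_spin_prod \<sigma>' S)"
      by (simp add: node_spin_prod_def)
  qed
  finally show ?thesis .
qed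

text \<open>Negating the second spin everywhere preserves the weight and gives one sign per node of
  \<open>S\<close>.\<close>

lemma odd_node_correlation_eq_0:
  assumes graph: "simple_graph V E" and S: "finite S" "vertex ` S \<subseteq> V" "odd (card S)"
  shows "measure_pmf.expectation (at_pmf V E J U)
    (\<lambda>(\<sigma>, \<sigma>'). node_spin_prod \<sigma> M * node_spin_prod \<sigma>' S) = 0"
proof (rule at_expectation_involution_eq_0[where T = "\<lambda>(\<sigma>, \<sigma>'). (\<sigma>, flip V \<sigma>')"])
  show "finite V"
    using graph by (simp add: simple_graph_def)
  fix \<omega> :: "('a \<Rightarrow> real) \<times> ('a \<Rightarrow> real)"
  assume "\<omega> \<in> spins V \<times> spins V"
  then obtain \<sigma> \<sigma>' where \<omega>: "\<omega> = (\<sigma>, \<sigma>')" "\<sigma> \<in> spins V" "\<sigma>' \<in> spins V"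
    by auto
  \<comment> \<open>Signs are counted over nodes rather than vertices: a vertex with both copies in
    \<open>S\<close> contributes two. The trivially true test puts the product into the form of
    \<open>prod_flip_sign\<close>.\<close>
  have "node_spin_prod (flip V \<sigma>') S = (\<Prod>x\<in>S. if x \<in> S then - \<sigma>' (vertex x) else \<sigma>' (vertex x))"
    unfolding node_spin_prod_def using S(2) by (intro prod.cong) (auto simp: flip_def)
  also have "\<dots> = - node_spin_prod \<sigma>' S"
    unfolding prod_flip_sign[OF S(1)] using S(3) by (simp add: node_spin_prod_def)
  finally have "node_spin_prod (flip V \<sigma>') S = - node_spin_prod \<sigma>' S" .
  then show "(case case \<omega> of (\<sigma>, \<sigma>') \<Rightarrow> (\<sigma>, flip V \<sigma>') of (\<sigma>, \<sigma>') \<Rightarrow> node_spin_prod \<sigma> M * node_spin_prod \<sigma>' S) =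
      - (case \<omega> of (\<sigma>, \<sigma>') \<Rightarrow> node_spin_prod \<sigma> M * node_spin_prod \<sigma>' S)"
    by (simp add: \<omega>)
  show "at_weight E J U (case \<omega> of (\<sigma>, \<sigma>') \<Rightarrow> (\<sigma>, flip V \<sigma>')) = at_weight E J U \<omega>"
    by (simp add: \<omega> at_weight_flip_second[OF graph])
  show "(case \<omega> of (\<sigma>, \<sigma>') \<Rightarrow> (\<sigma>, flip V \<sigma>')) \<in> spins V \<times> spins V"
    using \<omega> by (simp add: flip_in_spins)
  show "(case case \<omega> of (\<sigma>, \<sigma>') \<Rightarrow> (\<sigma>, flip V \<sigma>') of (\<sigma>, \<sigma>') \<Rightarrow> (\<sigma>, flip V \<sigma>')) = \<omega>"
    by (simp add: \<omega>)
qed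

section \<open>Decoupling for \<open>U = 0\<close>\<close>

lemma indep_var_pair_pmf:
  "prob_space.indep_var (measure_pmf (pair_pmf p q)) (count_space UNIV) fst (count_space UNIV) snd"
proof -
  \<comment> \<open>Preimages under one map already form a sigma-algebra, so independence of the
    generated sigma-algebras reduces to factorization on preimages.\<close>
  have vimage: "\<exists>A. a = h -` A" if "a \<in> sigma_sets UNIV {b. \<exists>A. b = h -` A}" for a and h :: "'c \<Rightarrow> 'd"
    using that
  proof (induction rule: sigma_sets.induct)
    case Empty
    then show ?case
      by (intro exI[of _ "{}"]) simp
  next
    case (Compl a)
    then obtain A where "a = h -` A"
      by blast
    then show ?case
      by (intro exI[of _ "- A"]) auto
  next
    case (Union a)
    then obtain A where "\<And>i. a i = h -` A i"
      by metis
    then show ?case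
      by (intro exI[of _ "\<Union>i. A i"]) auto
  qed blast
  have "measure_pmf.prob (pair_pmf p q) (fst -` A \<inter> snd -` B) =
      measure_pmf.prob (pair_pmf p q) (fst -` A) * measure_pmf.prob (pair_pmf p q) (snd -` B)" for A B
  proof -
    have "emeasure (pair_pmf p q) (fst -` A \<inter> snd -` B) = (\<integral>\<^sup>+x. indicator (fst -` A \<inter> snd -` B) x \<partial>pair_pmf p q)"
      by simp
    also have "\<dots> = (\<integral>\<^sup>+a. \<integral>\<^sup>+b. indicator A a * indicator B b \<partial>q \<partial>p)"
      unfolding nn_integral_pair_pmf' by (intro nn_integral_cong) (auto simp: indicator_def)
    also have "\<dots> = emeasure p A * emeasure q B"
      by (simp add: nn_integral_cmult nn_integral_multc)
    finally have "measure_pmf.prob (pair_pmf p q) (fst -` A \<inter> snd -` B) = measure_pmf.prob p A * measure_pmf.prob q B"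
      by (simp add: measure_pmf.emeasure_eq_measure ennreal_mult'[symmetric])
    moreover have "measure_pmf.prob p A = measure_pmf.prob (pair_pmf p q) (fst -` A)"
      by (metis map_fst_pair_pmf measure_map_pmf)
    moreover have "measure_pmf.prob q B = measure_pmf.prob (pair_pmf p q) (snd -` B)"
      by (metis map_snd_pair_pmf measure_map_pmf)
    ultimately show ?thesis
      by simp
  qed
  then have "measure_pmf.prob (pair_pmf p q) (a \<inter> b) =
      measure_pmf.prob (pair_pmf p q) a * measure_pmf.prob (pair_pmf p q) b"
    if "a \<in> sigma_sets UNIV {b. \<exists>A. b = fst -` A}" "b \<in> sigma_sets UNIV {b. \<exists>A. b = snd -` A}" for a b
    using vimage[OF that(1)] vimage[OF that(2)] by auto
  then show ?thesis
    unfolding prob_space.indep_var_eq[OF measure_pmf.prob_space_axioms]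
    by (auto intro!: prob_space.indep_setI[OF measure_pmf.prob_space_axioms])
qed

context
  fixes V :: "'a set" and E :: "'a set set" and J U :: "'a set \<Rightarrow> real"
  assumes V: "finite V" and U: "\<And>e. e \<in> E \<Longrightarrow> U e = 0"
begin

text \<open>The unnormalized Ising weight of a single copy with couplings \<open>J\<close>.\<close>

private definition w :: "('a \<Rightarrow> real) \<Rightarrow> real" where
  "w \<sigma> = (\<Prod>e\<in>E. exp (J e * spin_prod \<sigma> e))"

private lemma at_weight_decoupled: "at_weight E J U (\<sigma>, \<sigma>') = w \<sigma> * w \<sigma>'"
proof -
  have "at_weight E J U (\<sigma>, \<sigma>') = (\<Prod>e\<in>E. exp (J e * spin_prod \<sigma> e) * exp (J e * spin_prod \<sigma>' e))"
    unfolding at_weight_def prod.case using U by (intro prod.cong) (auto simp: exp_add distrib_left)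
  then show ?thesis
    by (simp add: w_def prod.distrib)
qed

private lemma w_pos: "w \<sigma> > 0"
  unfolding w_def by (intro prod_pos) auto

private lemma sum_decoupled:
  "(\<Sum>(\<sigma>, \<sigma>')\<in>spins V \<times> spins V. (f \<sigma> * w \<sigma>) * (g \<sigma>' * w \<sigma>')) =
    (\<Sum>\<sigma>\<in>spins V. f \<sigma> * w \<sigma>) * (\<Sum>\<sigma>\<in>spins V. g \<sigma> * w \<sigma>)"
  by (simp only: sum_product sum.cartesian_product)

private lemma at_partition_decoupled:
  "at_partition V E J U = (\<Sum>\<sigma>\<in>spins V. w \<sigma>) * (\<Sum>\<sigma>\<in>spins V. w \<sigma>)"
  using sum_decoupled[of "\<lambda>_. 1" "\<lambda>_. 1"] unfolding at_partition_def
  by (simp add: at_weight_decoupled case_prod_unfold flip: at_weight_decoupled)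

text \<open>Its square is the positive partition function, so this sum of positive weights is not
  zero.\<close>

private lemma sum_w_pos: "(\<Sum>\<sigma>\<in>spins V. w \<sigma>) > 0"
  using at_partition_pos[OF V, of E J U] w_pos unfolding at_partition_decoupled
  by (metis less_irrefl mult_zero_left order_le_less sum_nonneg)

text \<open>The last factor again averages over the first copy, so independence is combined with
  equality of the marginals. Each factor is recognised by taking the other function to be constant
  1.\<close>

lemma at_expectation_decoupled:
  fixes f g :: "('a \<Rightarrow> real) \<Rightarrow> real"
  shows
  "measure_pmf.expectation (at_pmf V E J U) (\<lambda>(\<sigma>, \<sigma>'). f \<sigma> * g \<sigma>') =
    measure_pmf.expectation (at_pmf V E J U) (\<lambda>(\<sigma>, \<sigma>'). f \<sigma>) *
    measure_pmf.expectation (at_pmf V E J U) (\<lambda>(\<sigma>, \<sigma>'). g \<sigma>)"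
proof -
  let ?z = "\<Sum>\<sigma>\<in>spins V. w \<sigma>"
  have E: "measure_pmf.expectation (at_pmf V E J U) (\<lambda>(\<sigma>, \<sigma>'). f \<sigma> * g \<sigma>') =
      (\<Sum>\<sigma>\<in>spins V. f \<sigma> * w \<sigma>) * (\<Sum>\<sigma>\<in>spins V. g \<sigma> * w \<sigma>) / (?z * ?z)" for f g :: "('a \<Rightarrow> real) \<Rightarrow> real"
    unfolding at_expectation[OF V] at_partition_decoupled sum_decoupled[symmetric]
    by (intro arg_cong2[of _ _ _ _ "(/)"] sum.cong) (auto simp: at_weight_decoupled)
  have "?z > 0"
    by (rule sum_w_pos)
  then show ?thesis
    using E[of f "\<lambda>_. 1"] E[of g "\<lambda>_. 1"] unfolding E[of f g] by simp
qed

lemma at_pmf_decoupled: "\<exists>p. at_pmf V E J U = pair_pmf p p"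
proof -
  let ?z = "\<Sum>\<sigma>\<in>spins V. w \<sigma>"
  let ?p = "\<lambda>\<sigma>. if \<sigma> \<in> spins V then w \<sigma> / ?z else 0"
  have z: "?z > 0"
    by (rule sum_w_pos)
  have nonneg: "0 \<le> ?p \<sigma>" for \<sigma>
    using z w_pos[of \<sigma>] by simp
  have "(\<integral>\<^sup>+\<sigma>. ennreal (?p \<sigma>) \<partial>count_space UNIV) = (\<Sum>\<sigma>\<in>spins V. ennreal (?p \<sigma>))"
    using finite_spins[OF V] by (intro nn_integral_count_space') auto
  also have "\<dots> = ennreal (\<Sum>\<sigma>\<in>spins V. ?p \<sigma>)"
    by (intro sum_ennreal nonneg)
  also have "(\<Sum>\<sigma>\<in>spins V. ?p \<sigma>) = (\<Sum>\<sigma>\<in>spins V. w \<sigma> / ?z)"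
    by (intro sum.cong) auto
  also have "\<dots> = 1"
    using z by (simp flip: sum_divide_distrib)
  finally have p: "pmf (embed_pmf ?p) \<sigma> = ?p \<sigma>" for \<sigma>
    using nonneg by (intro pmf_embed_pmf) auto
  have "at_pmf V E J U = pair_pmf (embed_pmf ?p) (embed_pmf ?p)"
  proof (rule pmf_eqI)
    fix \<omega> :: "('a \<Rightarrow> real) \<times> ('a \<Rightarrow> real)"
    obtain \<sigma> \<sigma>' where \<omega>: "\<omega> = (\<sigma>, \<sigma>')"
      by (rule prod.exhaust)
    show "pmf (at_pmf V E J U) \<omega> = pmf (pair_pmf (embed_pmf ?p) (embed_pmf ?p)) \<omega>"
      unfolding \<omega> pmf_pair p pmf_at_pmf[OF V]
      by (simp add: at_weight_decoupled at_partition_decoupled)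
  qed
  then show ?thesis
    by blast
qed

end

theorem corollary5:
  fixes V :: "'a set" and E :: "'a set set"
    and pos :: "'a \<Rightarrow> complex" and \<gamma> :: "'a set \<Rightarrow> real \<Rightarrow> complex" and \<beta> :: "real \<Rightarrow> complex"
    and J U :: "'a set \<Rightarrow> real"
    and A1 A2 B1 B2 :: "'a set" and vs :: "'a list"
    and X :: "complex set" and N R B :: "'a node set" and ns :: "'a node list"
    and expect :: "(('a \<Rightarrow> real) \<times> ('a \<Rightarrow> real) \<Rightarrow> real) \<Rightarrow> real"
  assumes graph: "simple_graph V E" "connected_graph V E"
    and embedding: "plane_embedding V E pos \<gamma>"
    and X: "X = drawing V E pos \<gamma>"
    and subset: "A1 \<union> A2 \<union> B1 \<union> B2 \<subseteq> V"
    and outer: "pos ` (A1 \<union> A2 \<union> B1 \<union> B2) \<subseteq> frontier (outer_face X)"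
    and disjoint: "A1 \<inter> A2 = {}" "A1 \<inter> B1 = {}" "A1 \<inter> B2 = {}"
      "A2 \<inter> B1 = {}" "A2 \<inter> B2 = {}" "B1 \<inter> B2 = {}"
    and walk: "outer_boundary_walk X \<beta>"
    and order: "distinct vs" "set vs = A1 \<union> A2 \<union> B1 \<union> B2" "counterclockwise \<beta> (map pos vs)"
    and N: "N = nodes (A1 \<union> B1) (A2 \<union> B2)"
    and R: "R = nodes A1 A2"
    and B: "B = nodes B1 B2"
    and ns: "ns = node_list (A2 \<union> B2) vs"
    and even: "even (card N)"
    and unbalanced: "\<not> balanced ns R B"
    and expect: "expect = measure_pmf.expectation (at_pmf V E J U)"
  shows
    "expect (\<lambda>(\<sigma>, \<sigma>'). (\<Prod>v\<in>A1. \<phi> \<sigma> \<sigma>' v) * (\<Prod>v\<in>A2. (\<phi> \<sigma> \<sigma>' v)\<^sup>2)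
                      * (\<Prod>v\<in>B1. \<phi>' \<sigma> \<sigma>' v) * (\<Prod>v\<in>B2. (\<phi>' \<sigma> \<sigma>' v)\<^sup>2))
       = 1 / 2 ^ card N * (\<Sum>S\<in>even_subsets N. (-1) ^ card (S \<inter> B) *
           expect (\<lambda>(\<sigma>, \<sigma>'). node_spin_prod \<sigma> (N - S) * node_spin_prod \<sigma>' S))
     \<and> 1 / 2 ^ card N * (\<Sum>S\<in>even_subsets N. (-1) ^ card (S \<inter> B) *
           expect (\<lambda>(\<sigma>, \<sigma>'). node_spin_prod \<sigma> (N - S) * node_spin_prod \<sigma>' S)) = 0
     \<and> ((\<forall>e\<in>E. U e = 0) \<longrightarrow>
          prob_space.indep_var (measure_pmf (at_pmf V E J U))
            (count_space UNIV) fst (count_space UNIV) snd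
        \<and> map_pmf fst (at_pmf V E J U) = map_pmf snd (at_pmf V E J U)
        \<and> (\<forall>S\<in>even_subsets N.
             expect (\<lambda>(\<sigma>, \<sigma>'). node_spin_prod \<sigma> (N - S) * node_spin_prod \<sigma>' S)
               = expect (\<lambda>(\<sigma>, \<sigma>'). node_spin_prod \<sigma> (N - S))
                 * expect (\<lambda>(\<sigma>, \<sigma>'). node_spin_prod \<sigma> S))
        \<and> (even (card B) \<longrightarrow>
             2 * expect (\<lambda>(\<sigma>, \<sigma>'). node_spin_prod \<sigma> N)
               = (\<Sum>S\<in>even_subsets N - {{}, N}. (-1) ^ (card (S \<inter> B) + 1) *
                   (expect (\<lambda>(\<sigma>, \<sigma>'). node_spin_prod \<sigma> S)
                    * expect (\<lambda>(\<sigma>, \<sigma>'). node_spin_prod \<sigma> (N - S))))))"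
proof -
  have V: "finite V"
    using graph(1) by (simp add: simple_graph_def)
  have fin: "finite A1" "finite A2" "finite B1" "finite B2"
    using finite_subset[OF subset V] by auto
  have RB: "R \<inter> B = {}" "N = R \<union> B"
    using disjoint by (auto simp: N R B nodes_def)
  have finN: "finite N"
    using fin by (simp add: N finite_nodes)
  have unb: "\<not> balanced (node_list (A2 \<union> B2) vs) (nodes A1 A2) (nodes B1 B2)"
    using unbalanced by (simp add: ns R B)
  have vertices: "vertex ` N \<subseteq> V"
    using subset by (auto simp: N nodes_def)
  define c :: "'a node set \<Rightarrow> real" where "c S = (-1) ^ card (S \<inter> B)" for S
  define G where "G S = (\<lambda>(\<sigma>, \<sigma>'). node_spin_prod \<sigma> (N - S) * node_spin_prod \<sigma>' S)"
    for S :: "'a node set"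
  have "phi_prod A1 A2 B1 B2 = (\<lambda>\<omega>. \<Sum>S\<in>Pow N. 1 / 2 ^ card N * c S * G S \<omega>)"
  proof
    fix \<omega> :: "('a \<Rightarrow> real) \<times> ('a \<Rightarrow> real)"
    obtain \<sigma> \<sigma>' where \<omega>: "\<omega> = (\<sigma>, \<sigma>')"
      by (rule prod.exhaust)
    show "phi_prod A1 A2 B1 B2 \<omega> = (\<Sum>S\<in>Pow N. 1 / 2 ^ card N * c S * G S \<omega>)"
      unfolding \<omega> phi_prod_expand[OF fin RB(1)[unfolded R B] RB(2)[unfolded R B]]
      by (simp add: c_def G_def B sum_distrib_left mult.assoc)
  qed
  then have "expect (phi_prod A1 A2 B1 B2) = (\<Sum>S\<in>Pow N. 1 / 2 ^ card N * c S * expect (G S))"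
    unfolding expect by (simp only: at_expectation_sum[OF V])
  also have "\<dots> = 1 / 2 ^ card N * (\<Sum>S\<in>Pow N. c S * expect (G S))"
    by (simp add: sum_distrib_left mult.assoc)
  \<comment> \<open>Multiplying out gives all subsets; those of odd size vanish by the global flip
    of the second spin.\<close>
  also have "(\<Sum>S\<in>Pow N. c S * expect (G S)) = (\<Sum>S\<in>even_subsets N. c S * expect (G S))"
  proof (rule sum.mono_neutral_right)
    show "\<forall>S\<in>Pow N - even_subsets N. c S * expect (G S) = 0"
    proof
      fix S assume S: "S \<in> Pow N - even_subsets N"
      then have "expect (G S) = 0"
        unfolding expect G_def using vertices finite_subset[OF _ finN]
        by (intro odd_node_correlation_eq_0[OF graph(1)]) (auto simp: even_subsets_def)
      then show "c S * expect (G S) = 0"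
        by simp
    qed
  qed (use finN in \<open>auto simp: even_subsets_def\<close>)
  finally have expansion: "expect (phi_prod A1 A2 B1 B2) =
      1 / 2 ^ card N * (\<Sum>S\<in>even_subsets N. c S * expect (G S))" .
  have zero: "expect (phi_prod A1 A2 B1 B2) = 0"
    unfolding expect
    by (rule phi_prod_expectation_eq_0[OF graph(1) embedding walk[unfolded X] subset disjoint order unb])
  have decoupled: "prob_space.indep_var (measure_pmf (at_pmf V E J U))
            (count_space UNIV) fst (count_space UNIV) snd
        \<and> map_pmf fst (at_pmf V E J U) = map_pmf snd (at_pmf V E J U)
        \<and> (\<forall>S\<in>even_subsets N. expect (G S) =
             expect (\<lambda>(\<sigma>, \<sigma>'). node_spin_prod \<sigma> (N - S)) * expect (\<lambda>(\<sigma>, \<sigma>'). node_spin_prod \<sigma> S))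
        \<and> (even (card B) \<longrightarrow>
             2 * expect (\<lambda>(\<sigma>, \<sigma>'). node_spin_prod \<sigma> N)
               = (\<Sum>S\<in>even_subsets N - {{}, N}. (-1) ^ (card (S \<inter> B) + 1) *
                   (expect (\<lambda>(\<sigma>, \<sigma>'). node_spin_prod \<sigma> S)
                    * expect (\<lambda>(\<sigma>, \<sigma>'). node_spin_prod \<sigma> (N - S)))))"
    if U: "\<forall>e\<in>E. U e = 0"
  proof (intro conjI ballI impI)
    obtain p where p: "at_pmf V E J U = pair_pmf p p"
      using at_pmf_decoupled[OF V, of E U J] U by blast
    show "prob_space.indep_var (measure_pmf (at_pmf V E J U))
            (count_space UNIV) fst (count_space UNIV) snd"
      unfolding p by (rule indep_var_pair_pmf)
    show "map_pmf fst (at_pmf V E J U) = map_pmf snd (at_pmf V E J U)"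
      unfolding p by (simp add: map_fst_pair_pmf map_snd_pair_pmf)
    define m where "m S = expect (\<lambda>(\<sigma>, \<sigma>'). node_spin_prod \<sigma> S)" for S
    show product: "expect (G S) =
        expect (\<lambda>(\<sigma>, \<sigma>'). node_spin_prod \<sigma> (N - S)) * expect (\<lambda>(\<sigma>, \<sigma>'). node_spin_prod \<sigma> S)" for S
      unfolding expect G_def using U by (intro at_expectation_decoupled[OF V]) auto
    assume evenB: "even (card B)"
    \<comment> \<open>Without nodes there would be neither sources nor sinks, hence balance. Thus
      \<open>{}\<close> and \<open>N\<close> are two different terms of the sum.\<close>
    have "N \<noteq> {}"
    proof
      assume "N = {}"
      then have "R = {}" "B = {}"
        using RB by auto
      then show False
        using unbalanced by (simp add: balanced_def sources_def sinks_def)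
    qed
    have m_empty: "m {} = 1"
      by (simp add: m_def expect node_spin_prod_def case_prod_unfold)
    have sub: "{{}, N} \<subseteq> even_subsets N" "finite (even_subsets N)"
      using even finN by (auto simp: even_subsets_def)
    have "0 = (\<Sum>S\<in>even_subsets N. c S * (m S * m (N - S)))"
      using zero expansion product by (simp add: m_def mult.commute)
    also have "\<dots> = (\<Sum>S\<in>even_subsets N - {{}, N}. c S * (m S * m (N - S))) +
        (\<Sum>S\<in>{{}, N}. c S * (m S * m (N - S)))"
      using sub by (rule sum.subset_diff)
    \<comment> \<open>Both terms equal \<open>m N\<close>: the sign at \<open>{}\<close> is trivial,
      the sign at \<open>N\<close> is \<open>(-1) ^ card B\<close>, which is 1 by
      \<open>evenB\<close>, and the empty correlation is 1.\<close>
    also have "(\<Sum>S\<in>{{}, N}. c S * (m S * m (N - S))) = 2 * m N"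
      using \<open>N \<noteq> {}\<close> evenB RB(2) m_empty by (simp add: c_def Int_absorb1)
    finally have "2 * m N = (\<Sum>S\<in>even_subsets N - {{}, N}. - (c S * (m S * m (N - S))))"
      by (simp add: sum_negf)
    then show "2 * expect (\<lambda>(\<sigma>, \<sigma>'). node_spin_prod \<sigma> N)
               = (\<Sum>S\<in>even_subsets N - {{}, N}. (-1) ^ (card (S \<inter> B) + 1) *
                   (expect (\<lambda>(\<sigma>, \<sigma>'). node_spin_prod \<sigma> S)
                    * expect (\<lambda>(\<sigma>, \<sigma>'). node_spin_prod \<sigma> (N - S))))"
      by (simp add: m_def c_def)
  qed
  show ?thesis
    using expansion zero decoupled unfolding G_def c_def phi_prod_def by auto
qed

end
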